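(* Let $T$ be an algebraic computation tree on $\mathbb{R}^n$ and let $G=[\![T]\!]$ be its translation, with edge set $E$, and let $\mathrm{Seq}_k(E)$ be the set of length-$k$ sequences of edges of $G$. Suppose $G$ computes the membership problem for $W\subseteq\mathbb{R}^n$ in $k$ steps. Then $W$ has at most $\mathrm{card}(\mathrm{Seq}_k(E))\cdot 2^{k\cdot h_0([G])+1}\cdot 3^{2k+n-1}$ connected components.
   Context: An algebraic computation tree on $\mathbb{R}^n$ is a binary tree in which: each vertex $v$ with one child carries an operation $f_v=f_{v_i}\star f_{v_j}$, $f_v=c\star f_{v_i}$ or $f_v=\sqrt{f_{v_i}}$, $\star\in\{+,-,\times,/\}$, $c\in\mathbb{R}$, $v_i,v_j$ ancestors or input variables; each vertex with two children carries a test $f_{v_i}\star0$, $\star\in\{>,=,\geqslant\}$; each leaf is labelled YES or NO. Translation $[\![T]\!]$: internal vertices numbered $n+1,\dots,n+\ell$ (root $n+1$), YES leaves merged into state $\top$, NO leaves into $\bot$; configuration space $\mathbb{R}^\omega\times S$ with $S=\{n+1,\dots,n+\ell,\top,\bot\}$ (product topology, $S$ discrete), register $i$ storing $f_{v_i}$, registers $1,\dots,n$ the inputs. Edges: an operation vertex $i$ with child $t$ gives one edge of source $\mathbb{R}^\omega\times\{i\}$ (restricted to $x_k\neq0$ for division by register $k$, to $x_k\geqslant0$ for square root of register $k$) setting register $i$ to the computed value and moving to $t$; a test vertex $i$ testing $f_{v_k}\star0$ with children $j$ (true), $j'$ (false) gives two edges of sources $\{x:x_k\star0\}\times\{i\}$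 and its complement $\times\{i\}$, identity on registers, moving to $j$, resp. $j'$. These edges have disjoint sources and define the partial map $[G]$. $G$ computes membership for $W$ in $k$ steps if for each $\vec x\in\mathbb{R}^n$, the control state of $[G]^k((x_1,\dots,x_n,0,\dots),n+1)$ is $\top$ iff $\vec x\in W$ ($\top,\bot$ absorbing). State cover entropy: $\mathcal S=(\mathbb{R}^\omega\times\{s\})_{s\in S}$; for a family $\mathcal V$ covering $Y$, $H^0_Y(\mathcal V)=\log_2$ of the minimal size of a covering subfamily; $f^{-1}(\mathcal U)=(f^{-1}(U_i))_i$; $\mathcal U\vee\mathcal V=(U_i\cap V_j)_{i,j}$; $H^k(f,\mathcal S)=\frac1kH^0_{f^{-k+1}(\mathbb{R}^\omega\times S)}(\mathcal S\vee f^{-1}(\mathcal S)\vee\dots\vee f^{-(k-1)}(\mathcal S))$; $h_0([G])=\lim_kH^k([G],\mathcal S)$. *)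

theory Defs
  imports "HOL-Analysis.Analysis"
begin

text \<open>
  All numberings start at 0 instead of 1: on \<open>\<real>\<^sup>n\<close> the input variables have the numbers
  \<open>0, \<dots>, n - 1\<close> and the internal vertices of a tree the numbers \<open>n, \<dots>, n + l - 1\<close>, the root
  being \<open>n\<close>.  The space \<open>\<real>\<^sup>\<omega>\<close> is \<^typ>\<open>nat \<Rightarrow> real\<close>, and \<open>\<real>\<^sup>n\<close> is \<open>Euclidean_space n\<close>, the sequences
  that vanish from index \<open>n\<close> on; a point \<open>x\<close> of it is thus literally the register content
  \<open>(x\<^sub>1, \<dots>, x\<^sub>n, 0, \<dots>)\<close>.
\<close>

section \<open>Algebraic computation trees\<close>

datatype arith = Add | Sub | Mul | Div

datatype relation = Greater | Equal | GreaterEq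

text \<open>Operands are numbers of input variables or of vertices.\<close>

datatype operation =
    Binary nat arith nat
  | Scalar real arith nat
  | Sqrt nat

text \<open>
  \<open>Compute v p t\<close> is a vertex with number \<open>v\<close>, operation \<open>p\<close> and child \<open>t\<close>.
  \<open>Test v i r t u\<close> is a vertex with number \<open>v\<close> testing \<open>f\<^sub>i r 0\<close>; its child is \<open>t\<close> if the test
  succeeds and \<open>u\<close> if it fails.
\<close>

datatype act =
    Leaf bool
  | Compute nat operation act
  | Test nat nat relation act act

fun operands :: "operation \<Rightarrow> nat set" where
  "operands (Binary i _ j) = {i, j}"
| "operands (Scalar _ _ i) = {i}"
| "operands (Sqrt i) = {i}"

fun vertices :: "act \<Rightarrow> nat list" where
  "vertices (Leaf _) = []"
| "vertices (Compute v _ t) = v # vertices t"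
| "vertices (Test v _ _ t u) = v # vertices t @ vertices u"

text \<open>
  \<open>refs_ok A t\<close>: every operand in \<open>t\<close> is in \<open>A\<close> or is a proper ancestor within \<open>t\<close>.  Only
  computation vertices \<open>v\<close> carry a value \<open>f\<^sub>v\<close>, so test vertices cannot be referred to.
\<close>

fun refs_ok :: "nat set \<Rightarrow> act \<Rightarrow> bool" where
  "refs_ok A (Leaf _) \<longleftrightarrow> True"
| "refs_ok A (Compute v p t) \<longleftrightarrow> operands p \<subseteq> A \<and> refs_ok (insert v A) t"
| "refs_ok A (Test v i _ t u) \<longleftrightarrow> i \<in> A \<and> refs_ok A t \<and> refs_ok A u"

text \<open>
  The root has to be an internal vertex, since its number is the initial control state.
  Apart from \<open>n\<close> for the root, the numbering is arbitrary.
\<close>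

definition act_on :: "nat \<Rightarrow> act \<Rightarrow> bool" where
  "act_on n T \<longleftrightarrow>
     vertices T \<noteq> [] \<and> hd (vertices T) = n \<and>
     distinct (vertices T) \<and> set (vertices T) = {n..<n + length (vertices T)} \<and>
     refs_ok {..<n} T"


section \<open>Translation into graphs acting on configurations\<close>

datatype state = Vertex nat | Top | Bot

type_synonym config = "(nat \<Rightarrow> real) \<times> state"

record edge =
  source :: "config set"
  realiser :: "(nat \<Rightarrow> real) \<Rightarrow> (nat \<Rightarrow> real)"
  target :: state

record graph =
  states :: "state set"
  edges :: "edge set"

fun arith_val :: "arith \<Rightarrow> real \<Rightarrow> real \<Rightarrow> real" where
  "arith_val Add a b = a + b"
| "arith_val Sub a b = a - b"
| "arith_val Mul a b = a * b"
| "arith_val Div a b = a / b"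

fun operation_val :: "operation \<Rightarrow> (nat \<Rightarrow> real) \<Rightarrow> real" where
  "operation_val (Binary i a j) x = arith_val a (x i) (x j)"
| "operation_val (Scalar c a i) x = arith_val a c (x i)"
| "operation_val (Sqrt i) x = sqrt (x i)"

fun operation_dom :: "operation \<Rightarrow> (nat \<Rightarrow> real) set" where
  "operation_dom (Binary i a j) = (if a = Div then {x. x j \<noteq> 0} else UNIV)"
| "operation_dom (Scalar c a i) = (if a = Div then {x. x i \<noteq> 0} else UNIV)"
| "operation_dom (Sqrt i) = {x. x i \<ge> 0}"

fun holds_zero :: "relation \<Rightarrow> real \<Rightarrow> bool" where
  "holds_zero Greater a \<longleftrightarrow> a > 0"
| "holds_zero Equal a \<longleftrightarrow> a = 0"
| "holds_zero GreaterEq a \<longleftrightarrow> a \<ge> 0"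

fun root_state :: "act \<Rightarrow> state" where
  "root_state (Leaf b) = (if b then Top else Bot)"
| "root_state (Compute v _ _) = Vertex v"
| "root_state (Test v _ _ _ _) = Vertex v"

fun act_edges :: "act \<Rightarrow> edge set" where
  "act_edges (Leaf _) = {}"
| "act_edges (Compute v p t) =
     insert \<lparr>source = operation_dom p \<times> {Vertex v},
             realiser = (\<lambda>x. x(v := operation_val p x)),
             target = root_state t\<rparr> (act_edges t)"
| "act_edges (Test v i r t u) =
     {\<lparr>source = {x. holds_zero r (x i)} \<times> {Vertex v}, realiser = id, target = root_state t\<rparr>,
      \<lparr>source = (- {x. holds_zero r (x i)}) \<times> {Vertex v}, realiser = id, target = root_state u\<rparr>}
     \<union> act_edges t \<union> act_edges u"

definition translation :: "act \<Rightarrow> graph" where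
  "translation T =
     \<lparr>states = Vertex ` set (vertices T) \<union> {Top, Bot}, edges = act_edges T\<rparr>"

definition config_space :: "graph \<Rightarrow> config set" where
  "config_space G = UNIV \<times> states G"

text \<open>
  The partial map of a graph whose edges have disjoint sources.  The states \<open>Top\<close> and \<open>Bot\<close> are
  absorbing: the map is the identity there, without this being counted as an edge.
\<close>

definition graph_map :: "graph \<Rightarrow> config \<rightharpoonup> config" where
  "graph_map G c =
     (if snd c \<in> {Top, Bot} then Some c
      else if \<exists>e\<in>edges G. c \<in> source e
        then (let e = (THE e. e \<in> edges G \<and> c \<in> source e) in Some (realiser e (fst c), target e))
      else None)"

definition Seq :: "nat \<Rightarrow> 'a set \<Rightarrow> 'a list set" where
  "Seq k E = {es. length es = k \<and> set es \<subseteq> E}"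


section \<open>Iteration and entropy of partial maps\<close>

fun piterate :: "('a \<rightharpoonup> 'a) \<Rightarrow> nat \<Rightarrow> 'a \<rightharpoonup> 'a" where
  "piterate f 0 = Some"
| "piterate f (Suc k) = piterate f k \<circ>\<^sub>m f"

definition preimage :: "('a \<rightharpoonup> 'b) \<Rightarrow> 'b set \<Rightarrow> 'a set" where
  "preimage f U = {c. \<exists>d\<in>U. f c = Some d}"

definition join :: "'a set set \<Rightarrow> 'a set set \<Rightarrow> 'a set set" where
  "join \<U> \<V> = {U \<inter> V | U V. U \<in> \<U> \<and> V \<in> \<V>}"

text \<open>\<open>iterated_join f \<U> m\<close> is \<open>\<U> \<or> f\<^sup>-\<^sup>1(\<U>) \<or> \<dots> \<or> f\<^sup>-\<^sup>m(\<U>)\<close>.\<close>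

fun iterated_join :: "('a \<rightharpoonup> 'a) \<Rightarrow> 'a set set \<Rightarrow> nat \<Rightarrow> 'a set set" where
  "iterated_join f \<U> 0 = \<U>"
| "iterated_join f \<U> (Suc m) =
     join (iterated_join f \<U> m) (preimage (piterate f (Suc m)) ` \<U>)"

definition cover_number :: "'a set \<Rightarrow> 'a set set \<Rightarrow> nat" where
  "cover_number Y \<V> = (LEAST m. \<exists>\<C>\<subseteq>\<V>. finite \<C> \<and> card \<C> = m \<and> Y \<subseteq> \<Union>\<C>)"

definition H0 :: "'a set \<Rightarrow> 'a set set \<Rightarrow> real" where
  "H0 Y \<V> = log 2 (real (cover_number Y \<V>))"

text \<open>\<open>Hk X f \<U> k\<close>, for a partial map \<open>f\<close> on \<open>X\<close>, is meaningful for \<open>k \<ge> 1\<close> only.\<close>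

definition Hk :: "'a set \<Rightarrow> ('a \<rightharpoonup> 'a) \<Rightarrow> 'a set set \<Rightarrow> nat \<Rightarrow> real" where
  "Hk X f \<U> k =
     1 / real k * H0 (preimage (piterate f (k - 1)) X) (iterated_join f \<U> (k - 1))"

definition state_cover :: "graph \<Rightarrow> config set set" where
  "state_cover G = {UNIV \<times> {s} | s. s \<in> states G}"

definition state_cover_entropy :: "graph \<Rightarrow> real" where
  "state_cover_entropy G = lim (Hk (config_space G) (graph_map G) (state_cover G))"


section \<open>Membership problems\<close>

definition computes_membership :: "graph \<Rightarrow> nat \<Rightarrow> (nat \<Rightarrow> real) set \<Rightarrow> nat \<Rightarrow> bool" where
  "computes_membership G n W k \<longleftrightarrow>
     (\<forall>x\<in>topspace (Euclidean_space n).
        (\<exists>y. piterate (graph_map G) k (x, Vertex n) = Some (y, Top)) \<longleftrightarrow> x \<in> W)"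

end

theory Submission imports Defs begin

text \<open>
  Adding at most two variables per computation vertex and one per test vertex turns a path of the
  tree into a system of quadratic equations, that is, into the zero set of a nonnegative polynomial
  \<open>F\<close> of degree 4.  A zero set in \<open>N\<close> variables of a nonnegative polynomial of degree \<open>d + 1\<close> has at
  most \<open>d ^ N\<close> components: near each component there are points at which the gradient of a
  perturbation of \<open>F\<close> takes any prescribed small value, and the number of solutions of \<open>N\<close> equations
  of degree \<open>d\<close> that are stable in this sense is bounded by a dimension count.  No transversality
  is needed.  The bound for the tree is the sum over its accepting paths; the number of edge
  sequences absorbs the number of paths, and the entropy of a translated tree is 0 since all orbits
  are absorbed within a bounded time.
\<close>


section \<open>Polynomial functions in finitely many variables\<close>

text \<open>Strict tests obstruct a quadratic encoding: \<open>y * u ^ 2 = 1\<close> for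
  \<open>y > 0\<close> is cubic. The proof therefore counts finite sets of points in distinct
  components instead of the components. A finite set keeps a positive margin \<open>m\<close> from
  every strict inequality, so that \<open>y - m = u ^ 2\<close> loses none of its points; and it
  lifts along continuous maps, so that equations and variables can be added vertex by vertex. The
  zero set of a sum of squares is singular, and its equations cannot be brought into general
  position directly. What survives is that each piece has, for every \<open>c\<close> in a small
  open box, a point nearby where the perturbed gradient equals \<open>c\<close>; a linear relation
  between polynomials can then be evaluated at all these points at once. The target contains
  \<open>3 ^ (2 * k + n - 1)\<close>, a third of the \<open>9 ^ k * 3 ^ n\<close> that one path of
  computations costs. The missing factor comes from a test, which costs 3 instead of 9, or from
  \<open>2 * card E \<ge> 3\<close>; a tree with one lone computation has neither and is replaced by
  a test.\<close>

definition expo :: "'i set \<Rightarrow> nat \<Rightarrow> ('i \<Rightarrow> nat) set" where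
  "expo I d = {e. (\<forall>i. i \<notin> I \<longrightarrow> e i = 0) \<and> sum e I \<le> d}"

definition monomial :: "'i set \<Rightarrow> ('i \<Rightarrow> nat) \<Rightarrow> ('i \<Rightarrow> real) \<Rightarrow> real" where
  "monomial I e z = (\<Prod>i\<in>I. z i ^ e i)"

text \<open>The span of the monomials, given by coefficient families on the finite set
  \<open>expo I d\<close>. Dimension counts are made on this index set instead of on a space of
  functions.\<close>

definition polys :: "'i set \<Rightarrow> nat \<Rightarrow> (('i \<Rightarrow> real) \<Rightarrow> real) set" where
  "polys I d = {f. \<exists>c. f = (\<lambda>z. \<Sum>e\<in>expo I d. c e * monomial I e z)}"

lemma polysI: "f = (\<lambda>z. \<Sum>e\<in>expo I d. c e * monomial I e z) \<Longrightarrow> f \<in> polys I d"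
  by (auto simp: polys_def)

lemma expo_mono: "d \<le> d' \<Longrightarrow> expo I d \<subseteq> expo I d'"
  by (auto simp: expo_def)

lemma expo_le:
  assumes "finite I" "e \<in> expo I d" shows "e i \<le> d"
proof (cases "i \<in> I")
  case True
  then have "e i \<le> sum e I" using assms(1) by (simp add: member_le_sum)
  then show ?thesis using assms(2) by (simp add: expo_def)
qed (use assms in \<open>auto simp: expo_def\<close>)

lemma expo_inj_restrict: "inj_on (\<lambda>e. restrict e I) (expo I d)"
proof (rule inj_onI)
  fix e e' assume *: "e \<in> expo I d" "e' \<in> expo I d" "restrict e I = restrict e' I"
  show "e = e'"
  proof
    fix i show "e i = e' i"
      using *(1,2) fun_cong[OF *(3), of i] by (cases "i \<in> I") (simp_all add: expo_def)
  qed
qed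

lemma expo_restrict:
  assumes "finite I" shows "(\<lambda>e. restrict e I) ` expo I d \<subseteq> I \<rightarrow>\<^sub>E {..d}"
  using expo_le[OF assms] by auto

lemma finite_expo: assumes "finite I" shows "finite (expo I d)"
  using assms by (intro finite_imageD[OF finite_subset[OF expo_restrict] expo_inj_restrict]) (simp_all add: finite_PiE)

text \<open>A crude box count, sufficient because only polynomial growth in \<open>d\<close> for
  fixed \<open>I\<close> is set against exponential growth in
  \<open>card_expo_growth\<close>.\<close>

lemma card_expo_le: assumes "finite I" shows "card (expo I d) \<le> (d + 1) ^ card I"
proof -
  have "card (expo I d) \<le> card (I \<rightarrow>\<^sub>E {..d})"
    using card_inj_on_le[OF expo_inj_restrict expo_restrict[OF assms]] assms
    by (simp add: finite_PiE)
  then show ?thesis using assms by (simp add: card_PiE)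
qed

lemma expo_nonempty: "(\<lambda>_. 0) \<in> expo I d"
  by (simp add: expo_def)

lemma monomial_add: "monomial I (\<lambda>i. e i + e' i) z = monomial I e z * monomial I e' z"
  by (simp add: monomial_def power_add prod.distrib)

lemma monomial_polys:
  assumes "finite I" "e \<in> expo I d" shows "monomial I e \<in> polys I d"
proof -
  have "monomial I e = (\<lambda>z. \<Sum>e'\<in>expo I d. of_bool (e' = e) * monomial I e' z)"
    using assms finite_expo[of I d] by (simp add: of_bool_def if_distrib if_distribR sum.If_cases cong: if_cong)
  then show ?thesis by (rule polysI)
qed

lemma polys_add:
  assumes "f \<in> polys I d" "g \<in> polys I d" shows "(\<lambda>z. f z + g z) \<in> polys I d"
proof -
  obtain c c' where "f = (\<lambda>z. \<Sum>e\<in>expo I d. c e * monomial I e z)" "g = (\<lambda>z. \<Sum>e\<in>expo I d. c' e * monomial I e z)"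
    using assms by (auto simp: polys_def)
  then have "(\<lambda>z. f z + g z) = (\<lambda>z. \<Sum>e\<in>expo I d. (c e + c' e) * monomial I e z)"
    by (simp add: sum.distrib distrib_right)
  then show ?thesis by (rule polysI)
qed

lemma polys_cmult:
  assumes "f \<in> polys I d" shows "(\<lambda>z. a * f z) \<in> polys I d"
proof -
  obtain c where "f = (\<lambda>z. \<Sum>e\<in>expo I d. c e * monomial I e z)"
    using assms by (auto simp: polys_def)
  then have "(\<lambda>z. a * f z) = (\<lambda>z. \<Sum>e\<in>expo I d. (a * c e) * monomial I e z)"
    by (simp add: sum_distrib_left mult.assoc)
  then show ?thesis by (rule polysI)
qed

lemma polys_0: "(\<lambda>z. 0) \<in> polys I d"
  by (rule polysI[where c = "\<lambda>_. 0"]) simp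

lemma polys_sum:
  assumes "\<And>s. s \<in> S \<Longrightarrow> f s \<in> polys I d" shows "(\<lambda>z. \<Sum>s\<in>S. f s z) \<in> polys I d"
  using assms by (induction S rule: infinite_finite_induct) (auto intro: polys_0 polys_add)

lemma polys_mono:
  assumes "finite I" "d \<le> d'" shows "polys I d \<subseteq> polys I d'"
proof
  fix f assume "f \<in> polys I d"
  then obtain c where f: "f = (\<lambda>z. \<Sum>e\<in>expo I d. c e * monomial I e z)"
    by (auto simp: polys_def)
  show "f \<in> polys I d'" unfolding f
    using expo_mono[OF assms(2)] by (intro polys_sum polys_cmult monomial_polys assms(1)) blast
qed

lemma polys_mult:
  assumes I: "finite I" and "f \<in> polys I d" "g \<in> polys I d'"
  shows "(\<lambda>z. f z * g z) \<in> polys I (d + d')"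
proof -
  obtain c c' where f: "f = (\<lambda>z. \<Sum>e\<in>expo I d. c e * monomial I e z)"
    and g: "g = (\<lambda>z. \<Sum>e\<in>expo I d'. c' e * monomial I e z)"
    using assms by (auto simp: polys_def)
  have "(\<lambda>z. f z * g z)
      = (\<lambda>z. \<Sum>e\<in>expo I d. \<Sum>e'\<in>expo I d'. (c e * c' e') * monomial I (\<lambda>i. e i + e' i) z)"
    unfolding f g sum_product by (intro ext sum.cong refl) (simp add: monomial_add)
  moreover have "(\<lambda>i. e i + e' i) \<in> expo I (d + d')" if "e \<in> expo I d" "e' \<in> expo I d'" for e e'
    using that by (auto simp: expo_def sum.distrib)
  ultimately show ?thesis
    by (auto intro!: polys_sum polys_cmult monomial_polys I)
qed

lemma polys_const: assumes "finite I" shows "(\<lambda>z. a) \<in> polys I d"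
  using polys_cmult[OF monomial_polys[OF assms expo_nonempty[of I d]], of a] by (simp add: monomial_def)

lemma polys_var:
  assumes "finite I" "i \<in> I" "1 \<le> d" shows "(\<lambda>z. z i) \<in> polys I d"
proof -
  have "monomial I (\<lambda>j. of_bool (j = i)) = (\<lambda>z. z i)"
    using assms by (auto simp: monomial_def of_bool_def if_distrib[of "\<lambda>n. _ ^ n"] cong: if_cong)
  moreover have "(\<lambda>j. of_bool (j = i)) \<in> expo I d"
    using assms by (auto simp: expo_def of_bool_def)
  ultimately show ?thesis using monomial_polys[OF assms(1)] by metis
qed

lemma polys_power:
  assumes "finite I" "f \<in> polys I d" shows "(\<lambda>z. f z ^ m) \<in> polys I (d * m)"
proof (induction m)
  case 0
  then show ?case by (simp add: polys_const assms)
next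
  case (Suc m)
  then show ?case using polys_mult[OF assms Suc] by simp
qed

text \<open>For the dimension count, where monomials of degree at most \<open>m\<close> are taken in
  the polynomials \<open>f k\<close> themselves.\<close>

lemma polys_monomial:
  assumes I: "finite I" and f: "\<And>k. k \<in> I \<Longrightarrow> f k \<in> polys I d" and e: "e \<in> expo I m"
  shows "(\<lambda>z. monomial I e (\<lambda>k. f k z)) \<in> polys I (d * m)"
proof -
  have "(\<lambda>z. \<Prod>k\<in>J. f k z ^ e k) \<in> polys I (d * sum e J)" if "J \<subseteq> I" for J
    using finite_subset[OF that I] that
  proof (induction J)
    case empty
    then show ?case by (simp add: polys_const I)
  next
    case (insert k J)
    then have "(\<lambda>z. f k z ^ e k * (\<Prod>k\<in>J. f k z ^ e k)) \<in> polys I (d * e k + d * sum e J)"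
      by (intro polys_mult polys_power I f) auto
    then show ?case using insert by (simp add: distrib_left)
  qed
  then have "(\<lambda>z. monomial I e (\<lambda>k. f k z)) \<in> polys I (d * sum e I)"
    by (simp add: monomial_def)
  then show ?thesis using polys_mono[OF I, of "d * sum e I" "d * m"] e by (auto simp: expo_def)
qed

lemma polys_continuous:
  assumes "f \<in> polys I d" shows "continuous_on S f"
proof -
  obtain c where f: "f = (\<lambda>z. \<Sum>e\<in>expo I d. c e * monomial I e z)"
    using assms by (auto simp: polys_def)
  have "continuous_on S (\<lambda>z. z i)" for i :: 'a
    by (rule continuous_on_subset[OF continuous_on_product_coordinates subset_UNIV])
  then show ?thesis unfolding f monomial_def
    by (intro continuous_on_sum continuous_on_mult continuous_on_const continuous_on_prod continuous_on_power)
qed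

lemma monomial_upd:
  assumes "finite I" "i \<in> I"
  shows "monomial I e (z(i := t)) = t ^ e i * (\<Prod>j\<in>I-{i}. z j ^ e j)"
  unfolding monomial_def prod.remove[OF assms] by (auto intro!: prod.cong)

lemma polys_partial_derivative:
  assumes I: "finite I" "i \<in> I" and "f \<in> polys I (Suc d)"
  shows "\<exists>f'\<in>polys I d. \<forall>z. ((\<lambda>t. f (z(i := t))) has_real_derivative f' z) (at (z i))"
proof -
  obtain c where f: "f = (\<lambda>z. \<Sum>e\<in>expo I (Suc d). c e * monomial I e z)"
    using assms by (auto simp: polys_def)
  \<comment> \<open>If \<open>e i = 0\<close>, truncated subtraction leaves the exponent unchanged,
    possibly of degree \<open>Suc d\<close>; the factor \<open>real (e i)\<close> removes this
    term.\<close>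
  define D where "D e = (\<lambda>z. real (e i) * (monomial I (e(i := e i - 1)) z))" for e
  have Dpoly: "D e \<in> polys I d" if "e \<in> expo I (Suc d)" for e
  proof (cases "e i = 0")
    case True
    then show ?thesis by (simp add: D_def polys_0)
  next
    case False
    have "sum (e(i := e i - 1)) I = (e i - 1) + sum e (I - {i})"
      unfolding sum.remove[OF I] by (auto intro!: sum.cong)
    moreover have "sum e I = e i + sum e (I - {i})" using sum.remove[OF I] .
    ultimately have "e(i := e i - 1) \<in> expo I d"
      using that False I by (auto simp: expo_def)
    then show ?thesis unfolding D_def by (intro polys_cmult monomial_polys I)
  qed
  have "((\<lambda>t. monomial I e (z(i := t))) has_real_derivative D e z) (at (z i))" for e z
  proof -
    have "D e z = real (e i) * z i ^ (e i - 1) * (\<Prod>j\<in>I-{i}. z j ^ e j)"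
      using monomial_upd[OF I, of "e(i := e i - 1)" z "z i"]
      by (simp add: D_def)
    then show ?thesis unfolding monomial_upd[OF I]
      by (auto intro!: derivative_eq_intros)
  qed
  then have "((\<lambda>t. f (z(i := t))) has_real_derivative (\<Sum>e\<in>expo I (Suc d). c e * D e z)) (at (z i))" for z
    unfolding f by (intro DERIV_sum DERIV_cmult)
  moreover have "(\<lambda>z. \<Sum>e\<in>expo I (Suc d). c e * D e z) \<in> polys I d"
    by (intro polys_sum polys_cmult Dpoly)
  ultimately show ?thesis by (intro bexI[of _ "\<lambda>z. \<Sum>e\<in>expo I (Suc d). c e * D e z"] allI)
qed

section \<open>Linear dependence, non-roots and growth of polynomial spaces\<close>

text \<open>Gaussian elimination by induction on the equations: an unknown \<open>a0\<close>
  occurring in equation \<open>b\<close> is eliminated from the others, and its value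
  \<open>r\<close> is recovered from \<open>b\<close> afterwards.\<close>

lemma homogeneous_system_nontrivial_solution:
  fixes M :: "'a \<Rightarrow> 'b \<Rightarrow> real"
  assumes "finite B" "finite A" "card B < card A"
  shows "\<exists>c. (\<exists>a\<in>A. c a \<noteq> 0) \<and> (\<forall>b\<in>B. (\<Sum>a\<in>A. c a * M a b) = 0)"
  using assms
proof (induction B arbitrary: A M)
  case empty
  then obtain a where "a \<in> A" by fastforce
  then show ?case by (intro exI[of _ "\<lambda>_. 1"]) auto
next
  case (insert b B)
  show ?case
  proof (cases "\<forall>a\<in>A. M a b = 0")
    case True
    then show ?thesis using insert.IH[of A M] insert by auto
  next
    case False
    then obtain a0 where a0: "a0 \<in> A" "M a0 b \<noteq> 0" by blast
    have "card B < card (A - {a0})" using insert.prems insert.hyps a0 by simp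
    from insert.IH[OF finite_Diff[OF insert.prems(1)] this, of "\<lambda>a b'. M a b' - M a b / M a0 b * M a0 b'"]
    obtain c where c: "\<exists>a\<in>A - {a0}. c a \<noteq> 0"
      "\<forall>b'\<in>B. (\<Sum>a\<in>A - {a0}. c a * (M a b' - M a b / M a0 b * M a0 b')) = 0"
      by (elim exE conjE)
    define r where "r = - (\<Sum>a\<in>A - {a0}. c a * M a b) / M a0 b"
    define c' where "c' = c(a0 := r)"
    have split: "(\<Sum>a\<in>A. c' a * M a b') = r * M a0 b' + (\<Sum>a\<in>A - {a0}. c a * M a b')" for b'
      using sum.remove[OF \<open>finite A\<close> a0(1), of "\<lambda>a. c' a * M a b'"]
      by (simp add: c'_def)
    have "(\<Sum>a\<in>A. c' a * M a b') = 0" if "b' \<in> insert b B" for b'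
    proof (cases "b' = b")
      case True
      then show ?thesis unfolding split using a0 by (simp add: r_def)
    next
      case False
      then have "0 = (\<Sum>a\<in>A - {a0}. c a * (M a b' - M a b / M a0 b * M a0 b'))" using c that by auto
      also have "\<dots> = (\<Sum>a\<in>A - {a0}. c a * M a b') - (\<Sum>a\<in>A - {a0}. c a * M a b) / M a0 b * M a0 b'"
        by (simp add: algebra_simps sum_subtractf sum_distrib_left sum_divide_distrib)
      finally show ?thesis unfolding split by (simp add: r_def)
    qed
    then show ?thesis using c(1) by (intro exI[of _ c']) (auto simp: c'_def)
  qed
qed

text \<open>Induction on the variables. Terms are grouped by the power of variable \<open>i\<close>;
  the coefficient of the power \<open>e0 i\<close> is nonzero at some small \<open>c\<close> by
  induction, which leaves a nonzero polynomial in one variable, with finitely many roots. The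
  exponent set \<open>S\<close> is general because the induction passes to a slice of it.\<close>

lemma nonzero_polynomial_small_nonroot:
  fixes P :: "('i \<Rightarrow> nat) \<Rightarrow> real"
  assumes "finite I" "finite S" "\<And>e i. e \<in> S \<Longrightarrow> i \<notin> I \<Longrightarrow> e i = 0" "e0 \<in> S" "P e0 \<noteq> 0" "0 < \<delta>"
  shows "\<exists>c. (\<forall>i\<in>I. 0 < c i \<and> c i < \<delta>) \<and> (\<Sum>e\<in>S. P e * monomial I e c) \<noteq> 0"
  using assms(1-5)
proof (induction I arbitrary: S P e0)
  case empty
  then have "e = (\<lambda>_. 0)" if "e \<in> S" for e using that by auto
  then have "S = {e0}" using empty by (metis empty_iff insertI1 set_eq_iff singletonD subsetI subset_antisym)
  then show ?case using empty by (auto simp: monomial_def)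
next
  case (insert i I)
  define m0 where "m0 = e0 i"
  define S0 where "S0 m = {e \<in> S. e i = m}" for m
  define h where "h e = e(i := 0)" for e :: "'i \<Rightarrow> nat"
  have inj: "inj_on h (S0 m)" for m
    unfolding h_def S0_def inj_on_def by (metis (mono_tags, lifting) fun_upd_triv fun_upd_upd mem_Collect_eq)
  obtain c where c: "\<forall>j\<in>I. 0 < c j \<and> c j < \<delta>"
    and nz: "(\<Sum>e\<in>h ` S0 m0. P (e(i := m0)) * monomial I e c) \<noteq> 0"
  proof -
    have "e j = 0" if "e \<in> h ` S0 m0" "j \<notin> I" for e j
      using that insert.prems(2) by (auto simp: h_def S0_def)
    moreover have "h e0 \<in> h ` S0 m0" using insert.prems by (auto simp: S0_def m0_def)
    moreover have "P ((h e0)(i := m0)) \<noteq> 0" using insert.prems by (simp add: h_def m0_def)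
    moreover have "finite (h ` S0 m0)" using insert.prems by (simp add: S0_def)
    ultimately show ?thesis
      using insert.IH[of "h ` S0 m0" "h e0" "\<lambda>e. P (e(i := m0))"] that by blast
  qed
  define q where "q m = (\<Sum>e\<in>S0 m. P e * monomial I e c)" for m
  have "q m0 = (\<Sum>e\<in>h ` S0 m0. P (e(i := m0)) * monomial I e c)"
    unfolding sum.reindex[OF inj] q_def
  proof (rule sum.cong)
    fix e assume "e \<in> S0 m0"
    then have "(h e)(i := m0) = e" by (auto simp: h_def S0_def)
    moreover have "monomial I (h e) c = monomial I e c"
      unfolding monomial_def h_def using insert.hyps by (intro prod.cong) auto
    ultimately show "P e * monomial I e c = ((\<lambda>e. P (e(i := m0)) * monomial I e c) \<circ> h) e" by simp
  qed simp
  then have q0: "q m0 \<noteq> 0" using nz by simp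
  define K where "K = Max ((\<lambda>e. e i) ` S)"
  have K: "e i \<le> K" if "e \<in> S" for e using that insert.prems by (simp add: K_def)
  have "finite {t. (\<Sum>m\<le>K. q m * t ^ m) = 0}"
    using q0 K[OF insert.prems(3)] unfolding polyfun_finite_roots m0_def by blast
  moreover have "infinite {0<..<\<delta>}" using assms(6) by simp
  ultimately obtain t where t: "0 < t" "t < \<delta>" "(\<Sum>m\<le>K. q m * t ^ m) \<noteq> 0"
    by (metis (mono_tags, lifting) finite_subset greaterThanLessThan_iff mem_Collect_eq subsetI)
  have mon: "monomial (insert i I) e (c(i := t)) = t ^ e i * monomial I e c" for e
  proof -
    have "(\<Prod>j\<in>I. (c(i := t)) j ^ e j) = (\<Prod>j\<in>I. c j ^ e j)"
      using insert.hyps by (intro prod.cong) auto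
    then show ?thesis unfolding monomial_def using insert.hyps by simp
  qed
  have "(\<Sum>e\<in>S. P e * monomial (insert i I) e (c(i := t)))
      = (\<Sum>m\<le>K. \<Sum>e\<in>{e\<in>S. e i = m}. P e * monomial (insert i I) e (c(i := t)))"
    using K insert.prems(1) by (subst sum.group) auto
  also have "\<dots> = (\<Sum>m\<le>K. q m * t ^ m)"
    unfolding mon q_def S0_def by (auto simp: sum_distrib_left sum_distrib_right mult_ac intro!: sum.cong)
  finally have "(\<Sum>e\<in>S. P e * monomial (insert i I) e (c(i := t))) \<noteq> 0" using t by simp
  moreover have "\<forall>j\<in>insert i I. 0 < (c(i := t)) j \<and> (c(i := t)) j < \<delta>" using t c by simp
  ultimately show ?case by blast
qed

text \<open>Each exponent is divided by \<open>d\<close> with remainder: the quotients lie in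
  \<open>expo I m\<close> and the remainders give the factor \<open>d ^ card I\<close>, which is the
  Bezout number of the final bound.\<close>

lemma card_expo_div_mod:
  assumes I: "finite I" and d: "0 < d"
  shows "card (expo I (d * m + (d - 1))) \<le> d ^ card I * card (expo I m)"
proof -
  define h where "h e = (\<lambda>i. e i div d, restrict (\<lambda>i. e i mod d) I)" for e :: "'a \<Rightarrow> nat"
  have "inj_on h (expo I (d * m + (d - 1)))"
  proof (rule inj_onI)
    fix e e' assume *: "e \<in> expo I (d * m + (d - 1))" "e' \<in> expo I (d * m + (d - 1))" "h e = h e'"
    show "e = e'"
    proof
      fix i
      show "e i = e' i"
      proof (cases "i \<in> I")
        case True
        have "fst (h e) i = fst (h e') i" "snd (h e) i = snd (h e') i" using *(3) by simp_all
        then have "e i div d = e' i div d" "e i mod d = e' i mod d" using True by (simp_all add: h_def)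
        then show ?thesis by (metis div_mult_mod_eq)
      qed (use *(1,2) in \<open>simp add: expo_def\<close>)
    qed
  qed
  moreover have "h ` expo I (d * m + (d - 1)) \<subseteq> expo I m \<times> (I \<rightarrow>\<^sub>E {..<d})"
  proof (rule image_subsetI)
    fix e assume e: "e \<in> expo I (d * m + (d - 1))"
    have "d * (\<Sum>i\<in>I. e i div d) \<le> sum e I"
      by (simp add: sum_distrib_left) (intro sum_mono, simp)
    also have "\<dots> \<le> d * m + (d - 1)" using e by (simp add: expo_def)
    also have "\<dots> < d * (m + 1)" using d by simp
    finally have "(\<Sum>i\<in>I. e i div d) \<le> m" by (metis Suc_eq_plus1 less_Suc_eq_le mult_less_cancel1)
    then show "h e \<in> expo I m \<times> (I \<rightarrow>\<^sub>E {..<d})"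
      using e d by (auto simp: expo_def h_def)
  qed
  ultimately have "card (expo I (d * m + (d - 1))) \<le> card (expo I m \<times> (I \<rightarrow>\<^sub>E {..<d}))"
    by (intro card_inj_on_le) (auto simp: finite_expo I finite_PiE)
  then show ?thesis by (simp add: card_cartesian_product card_PiE I mult.commute)
qed

text \<open>A root \<open>r\<close> of \<open>q\<close> reduces the claim to linear growth against
  \<open>r ^ j\<close>. Its order is \<open>Suc N\<close> instead of \<open>N\<close> so that
  \<open>N = 0\<close> is covered.\<close>

lemma exponential_beats_power:
  fixes q :: real assumes "1 < q" shows "\<exists>j. real ((a * j + 1) ^ N) < q ^ j"
proof -
  define r where "r = root (Suc N) q"
  have r: "1 < r" "r ^ Suc N = q"
    using assms real_root_pow_pos2[of "Suc N" q] by (simp_all add: r_def del: power_Suc)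
  have "(\<lambda>j. real a * (real j * (1 / r) ^ j) + (1 / r) ^ j) \<longlonglongrightarrow> real a * 0 + 0"
    using r by (intro tendsto_intros powser_times_n_limit_0 LIMSEQ_realpow_zero) auto
  then have "eventually (\<lambda>j. real a * (real j * (1 / r) ^ j) + (1 / r) ^ j < 1) sequentially"
    by (rule order_tendstoD(2)) simp
  then obtain j where "real a * (real j * (1 / r) ^ j) + (1 / r) ^ j < 1"
    using eventually_happens'[OF sequentially_bot] by blast
  then have "(real a * real j + 1) / r ^ j < 1"
    by (simp add: power_one_over add_divide_distrib)
  then have "real (a * j + 1) < r ^ j"
    using r by (simp add: pos_divide_less_eq)
  then have "real (a * j + 1) ^ Suc N < (r ^ j) ^ Suc N"
    by (intro power_strict_mono) auto
  moreover have "real (a * j + 1) ^ N \<le> real (a * j + 1) ^ Suc N"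
    by (intro power_increasing) auto
  moreover have "(r ^ j) ^ Suc N = q ^ j" unfolding r(2)[symmetric] power_mult[symmetric] by (simp only: mult.commute)
  ultimately show ?thesis by (intro exI[of _ j]) (simp only: of_nat_power)
qed

text \<open>Otherwise \<open>card_expo_div_mod\<close> would make the dimension grow by a factor
  \<open>1 + 1 / D\<close> whenever the degree grows by \<open>a\<close>, hence exponentially in the
  degree. The shift \<open>a\<close> leaves room for the degree of auxiliary polynomials that are
  fixed before \<open>m\<close> is chosen.\<close>

lemma card_expo_growth:
  assumes I: "finite I" and d: "0 < d"
  shows "\<exists>m. card (expo I (d * m + a)) < (d ^ card I + 1) * card (expo I m)"
proof (rule ccontr)
  assume "\<not> ?thesis"
  then have ge: "(d ^ card I + 1) * card (expo I m) \<le> card (expo I (d * m + a))" for m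
    by (simp add: not_less)
  define D where "D = real (d ^ card I)"
  have D: "D > 0" using d by (simp add: D_def)
  have step: "(1 + 1 / D) * real (card (expo I m)) \<le> real (card (expo I (m + a)))" for m
  proof -
    \<comment> \<open>The shift is absorbed by enlarging \<open>m\<close> to \<open>m + a\<close>,
      which yields the degree required by \<open>card_expo_div_mod\<close>.\<close>
    have "1 * a \<le> d * a" using d by (intro mult_le_mono1) simp
    then have "d * m + a \<le> d * (m + a) + (d - 1)" unfolding distrib_left by linarith
    then have "card (expo I (d * m + a)) \<le> card (expo I (d * (m + a) + (d - 1)))"
      by (intro card_mono finite_expo I expo_mono)
    also have "\<dots> \<le> d ^ card I * card (expo I (m + a))" by (rule card_expo_div_mod[OF I d])
    finally have "(d ^ card I + 1) * card (expo I m) \<le> d ^ card I * card (expo I (m + a))"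
      using ge order_trans by blast
    then have "real ((d ^ card I + 1) * card (expo I m)) \<le> real (d ^ card I * card (expo I (m + a)))"
      by (rule of_nat_mono)
    then have "(D + 1) * real (card (expo I m)) \<le> D * real (card (expo I (m + a)))"
      by (simp add: D_def distrib_right add.commute)
    then show ?thesis using D by (simp add: field_simps)
  qed
  have "(1 + 1 / D) ^ j \<le> real (card (expo I (a * j)))" for j
  proof (induction j)
    case 0
    have "card (expo I 0) \<noteq> 0" using finite_expo[OF I, of 0] expo_nonempty[of I 0] by auto
    then show ?case by simp
  next
    case (Suc j)
    have "(1 + 1 / D) ^ Suc j \<le> (1 + 1 / D) * real (card (expo I (a * j)))"
      using Suc D by (simp add: mult_left_mono)
    also have "\<dots> \<le> real (card (expo I (a * Suc j)))" using step[of "a * j"] by (simp add: add.commute)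
    finally show ?case .
  qed
  moreover obtain j where "real ((a * j + 1) ^ card I) < (1 + 1 / D) ^ j"
    using exponential_beats_power[of "1 + 1 / D"] D by auto
  moreover have "real (card (expo I (a * j))) \<le> real ((a * j + 1) ^ card I)"
    using card_expo_le[OF I, of "a * j"] of_nat_mono by blast
  ultimately show False by (meson not_le order_trans)
qed

section \<open>Stable solutions of polynomial systems\<close>

text \<open>Opens the Stone-Weierstrass theory for polynomials; they separate points of
  \<open>K\<close> because these differ only in coordinates from \<open>I\<close>.\<close>

lemma polys_function_ring:
  assumes I: "finite I" and K: "compact K" and supp: "\<And>z i. z \<in> K \<Longrightarrow> i \<notin> I \<Longrightarrow> z i = 0"
  shows "function_ring_on (\<Union>d. polys I d) K"
proof
  fix f g assume f: "f \<in> (\<Union>d. polys I d)" and g: "g \<in> (\<Union>d. polys I d)"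
  then obtain d d' where d: "f \<in> polys I d" "g \<in> polys I d'" by blast
  then have "f \<in> polys I (max d d')" "g \<in> polys I (max d d')"
    using polys_mono[OF I, of d "max d d'"] polys_mono[OF I, of d' "max d d'"] by auto
  then show "(\<lambda>x. f x + g x) \<in> (\<Union>d. polys I d)" using polys_add by blast
  show "(\<lambda>x. f x * g x) \<in> (\<Union>d. polys I d)" using polys_mult[OF I d] by blast
next
  fix x y assume *: "x \<in> K" "y \<in> K" "x \<noteq> y"
  then obtain i where i: "x i \<noteq> y i" by blast
  then have "i \<in> I" using supp * by metis
  then show "\<exists>f\<in>\<Union>d. polys I d. f x \<noteq> f y"
    using polys_var[OF I, of i 1] i by (intro bexI[of _ "\<lambda>z. z i"]) auto
next
  fix f assume "f \<in> (\<Union>d. polys I d)"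
  then show "continuous_on K f" using polys_continuous by (elim UN_E)
next
  fix c show "(\<lambda>_. c) \<in> (\<Union>d. polys I d)" using polys_const[OF I] by (intro UN_I) auto
qed (rule K)

text \<open>Diagonal dominance: in the equation of an index where \<open>P\<close> has maximal
  modulus, the diagonal term outweighs the \<open>M - 1\<close> others together.\<close>

lemma near_identity_nonsingular:
  fixes P :: "nat \<Rightarrow> real" and G :: "nat \<Rightarrow> nat \<Rightarrow> real"
  assumes diag: "\<And>j. j < M \<Longrightarrow> G j j > 1 - 1 / real (2 * M)"
    and off: "\<And>i j. i < M \<Longrightarrow> j < M \<Longrightarrow> i \<noteq> j \<Longrightarrow> \<bar>G i j\<bar> < 1 / real (2 * M)"
    and sol: "\<And>j. j < M \<Longrightarrow> (\<Sum>i<M. P i * G i j) = 0" and j: "j < M"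
  shows "P j = 0"
proof -
  have "Max ((\<lambda>i. \<bar>P i\<bar>) ` {..<M}) \<in> (\<lambda>i. \<bar>P i\<bar>) ` {..<M}" using j by (intro Max_in) auto
  then obtain m where m: "m < M" "\<bar>P m\<bar> = Max ((\<lambda>i. \<bar>P i\<bar>) ` {..<M})" by force
  have max: "\<bar>P i\<bar> \<le> \<bar>P m\<bar>" if "i < M" for i unfolding m(2) using that by (intro Max_ge) auto
  define \<epsilon> where "\<epsilon> = 1 / real (2 * M)"
  have "0 = P m * G m m + (\<Sum>i\<in>{..<M} - {m}. P i * G i m)"
    using sol[OF m(1)] sum.remove[of "{..<M}" m "\<lambda>i. P i * G i m"] m(1) by simp
  then have "\<bar>P m * G m m\<bar> = \<bar>\<Sum>i\<in>{..<M} - {m}. P i * G i m\<bar>" by linarith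
  also have "\<dots> \<le> (\<Sum>i\<in>{..<M} - {m}. \<bar>P m\<bar> * \<epsilon>)"
  proof (rule order_trans[OF sum_abs sum_mono])
    fix i assume "i \<in> {..<M} - {m}"
    then show "\<bar>P i * G i m\<bar> \<le> \<bar>P m\<bar> * \<epsilon>"
      using max[of i] off[of i m] m(1) unfolding abs_mult \<epsilon>_def by (intro mult_mono) auto
  qed
  also have "\<dots> = \<bar>P m\<bar> * ((real M - 1) * \<epsilon>)" using m(1) by (simp add: of_nat_diff)
  finally have *: "\<bar>P m\<bar> * \<bar>G m m\<bar> \<le> \<bar>P m\<bar> * ((real M - 1) * \<epsilon>)" by (simp add: abs_mult)
  have "real M * \<epsilon> = 1 / 2" using m(1) by (simp add: \<epsilon>_def)
  then have "(real M - 1) * \<epsilon> < 1 - \<epsilon>" by (simp add: algebra_simps)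
  also have "\<dots> < \<bar>G m m\<bar>" using diag[OF m(1)] unfolding \<epsilon>_def by linarith
  finally have "\<bar>P m\<bar> = 0" using * by (metis abs_ge_zero mult_le_cancel_left_pos not_less order_le_less)
  then show ?thesis using max[OF j] by simp
qed

text \<open>
  A real form of Bezout's theorem: modulo the polynomials in \<open>f\<close>, any \<open>d ^ card I + 1\<close> polynomials
  are linearly dependent, by comparing dimensions; applied to polynomials that approximate the
  indicator functions of the \<open>K j\<close>, this bounds the number of the \<open>K j\<close>.
\<close>

theorem stable_solutions_bound:
  fixes f :: "'i::countable \<Rightarrow> ('i \<Rightarrow> real) \<Rightarrow> real" and K :: "nat \<Rightarrow> ('i \<Rightarrow> real) set"
  assumes I: "finite I" and d: "0 < d" and f: "\<And>k. k \<in> I \<Longrightarrow> f k \<in> polys I d"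
    and K: "\<And>j. j < M \<Longrightarrow> compact (K j)"
    and disj: "\<And>i j. i < M \<Longrightarrow> j < M \<Longrightarrow> i \<noteq> j \<Longrightarrow> K i \<inter> K j = {}"
    and supp: "\<And>j z i. j < M \<Longrightarrow> z \<in> K j \<Longrightarrow> i \<notin> I \<Longrightarrow> z i = 0"
    and \<kappa>: "0 < \<kappa>"
    and sol: "\<And>c j. j < M \<Longrightarrow> (\<And>k. k \<in> I \<Longrightarrow> 0 < c k \<and> c k < \<kappa>) \<Longrightarrow> \<exists>z\<in>K j. \<forall>k\<in>I. f k z = c k"
  shows "M \<le> d ^ card I"
proof (rule ccontr)
  assume "\<not> ?thesis"
  then have M: "d ^ card I + 1 \<le> M" by simp
  define S where "S = (\<Union>j<M. K j)"
  interpret function_ring_on "\<Union>d. polys I d" S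
    using supp unfolding S_def by (intro polys_function_ring I compact_UN K) auto
  define \<epsilon> where "\<epsilon> = 1 / real (2 * M)"
  have \<epsilon>: "0 < \<epsilon>" "\<epsilon> < 1" using M by (auto simp: \<epsilon>_def)
  define appr where "appr j g \<longleftrightarrow> g \<in> (\<Union>d. polys I d) \<and> g ` S \<subseteq> {0..1} \<and>
      (\<forall>x\<in>(\<Union>i\<in>{..<M}-{j}. K i). g x < \<epsilon>) \<and> (\<forall>x\<in>K j. g x > 1 - \<epsilon>)" for j g
  have "\<exists>g. appr j g" if j: "j < M" for j
  proof -
    have A: "closed (\<Union>i\<in>{..<M}-{j}. K i)" "(\<Union>i\<in>{..<M}-{j}. K i) \<subseteq> S"
      by (intro closed_UN ballI compact_imp_closed K) (auto simp: S_def)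
    have B: "closed (K j)" "K j \<subseteq> S" using j by (auto simp: S_def intro: compact_imp_closed K)
    have "(\<Union>i\<in>{..<M}-{j}. K i) \<inter> K j = {}" using disj j by blast
    \<comment> \<open>\<open>two\<close> is the separation step of the Stone-Weierstrass theorem: a
      polynomial with values in \<open>{0..1}\<close> that is small on one closed set and close to 1
      on the other.\<close>
    from two[OF A B this \<epsilon>] show ?thesis unfolding appr_def Bex_def .
  qed
  then obtain g where appr: "\<And>j. j < M \<Longrightarrow> appr j (g j)" by metis
  have g: "g j \<in> (\<Union>d. polys I d)" "g j ` S \<subseteq> {0..1}"
    "\<forall>x\<in>(\<Union>i\<in>{..<M}-{j}. K i). g j x < \<epsilon>" "\<forall>x\<in>K j. g j x > 1 - \<epsilon>" if "j < M" for j
    using appr[OF that] unfolding appr_def by simp_all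
  have g_range: "0 \<le> g j x" if "j < M" "x \<in> S" for j x
    using subsetD[OF g(2)[OF that(1)] imageI[OF that(2)]] by simp
  have g_off: "g j x < \<epsilon>" if "j < M" "i < M" "i \<noteq> j" "x \<in> K i" for i j x
    using g(3)[OF that(1)] that(2-) by auto
  have g_diag: "g j x > 1 - \<epsilon>" if "j < M" "x \<in> K j" for j x
    using g(4)[OF that(1)] that(2) by blast
  have "\<exists>d. g j \<in> polys I d" if "j < M" for j
    using g(1)[OF that] by blast
  then obtain r where r: "\<And>j. j < M \<Longrightarrow> g j \<in> polys I (r j)" by metis
  define a where "a = (\<Sum>j<M. r j)"
  have ga: "g j \<in> polys I a" if "j < M" for j
    using r[OF that] polys_mono[OF I, of "r j" a] that member_le_sum[of j "{..<M}" r] by (auto simp: a_def)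
  \<comment> \<open>The \<open>M * card (expo I m)\<close> products of a monomial in the
    \<open>f k\<close> with some \<open>g j\<close> all have degree at most
    \<open>d * m + a\<close>. For this \<open>m\<close> they outnumber the monomials of that degree,
    hence the relation \<open>P\<close>.\<close>
  obtain m where "card (expo I (d * m + a)) < (d ^ card I + 1) * card (expo I m)"
    using card_expo_growth[OF I d] by blast
  also have "\<dots> \<le> M * card (expo I m)" using M by (rule mult_le_mono1)
  finally have card: "card (expo I (d * m + a)) < card ({..<M} \<times> expo I m)" 
    by (simp add: card_cartesian_product)
  have "(\<lambda>z. monomial I e (\<lambda>k. f k z) * g j z) \<in> polys I (d * m + a)"
    if "j < M" "e \<in> expo I m" for j e
    using that by (intro polys_mult polys_monomial I f ga)
  then have "\<forall>p\<in>{..<M} \<times> expo I m. \<exists>c. (\<lambda>z. monomial I (snd p) (\<lambda>k. f k z) * g (fst p) z)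
       = (\<lambda>z. \<Sum>b\<in>expo I (d * m + a). c b * monomial I b z)"
    unfolding polys_def by fastforce
  from bchoice[OF this] obtain C where C: "\<forall>p\<in>{..<M} \<times> expo I m. (\<lambda>z. monomial I (snd p) (\<lambda>k. f k z) * g (fst p) z)
       = (\<lambda>z. \<Sum>b\<in>expo I (d * m + a). C p b * monomial I b z)" ..
  have "finite ({..<M} \<times> expo I m)" by (simp add: finite_expo I)
  from homogeneous_system_nontrivial_solution[OF finite_expo[OF I] this card, of C]
  obtain P where P: "\<exists>p\<in>{..<M} \<times> expo I m. P p \<noteq> 0"
    "\<forall>b\<in>expo I (d * m + a). (\<Sum>p\<in>{..<M} \<times> expo I m. P p * C p b) = 0"
    by (elim exE conjE)
  have rel: "(\<Sum>j<M. (\<Sum>e\<in>expo I m. P (j, e) * monomial I e (\<lambda>k. f k z)) * g j z) = 0" for z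
  proof -
    have "(\<Sum>j<M. (\<Sum>e\<in>expo I m. P (j, e) * monomial I e (\<lambda>k. f k z)) * g j z)
        = (\<Sum>p\<in>{..<M} \<times> expo I m. P p * (monomial I (snd p) (\<lambda>k. f k z) * g (fst p) z))"
      by (simp add: sum_distrib_right sum.cartesian_product case_prod_beta mult.assoc)
    also have "\<dots> = (\<Sum>p\<in>{..<M} \<times> expo I m. P p * (\<Sum>b\<in>expo I (d * m + a). C p b * monomial I b z))"
      using fun_cong[OF bspec[OF C]] by (intro sum.cong refl) simp
    also have "\<dots> = (\<Sum>p\<in>{..<M} \<times> expo I m. \<Sum>b\<in>expo I (d * m + a). P p * C p b * monomial I b z)"
      by (simp add: sum_distrib_left mult.assoc)
    also have "\<dots> = (\<Sum>b\<in>expo I (d * m + a). (\<Sum>p\<in>{..<M} \<times> expo I m. P p * C p b) * monomial I b z)"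
      by (subst sum.swap) (simp add: sum_distrib_right)
    also have "\<dots> = 0" using P(2) by simp
    finally show ?thesis .
  qed
  \<comment> \<open>The coefficient of this \<open>g j\<close> in \<open>rel\<close> is a nonzero
    polynomial in the values of the \<open>f k\<close>, so it is nonzero at some \<open>c\<close> in
    the box where \<open>sol\<close> applies.\<close>
  obtain j e where je: "j < M" "e \<in> expo I m" "P (j, e) \<noteq> 0" using P(1) by auto
  have "\<exists>c. (\<forall>k\<in>I. 0 < c k \<and> c k < \<kappa>) \<and> (\<Sum>e\<in>expo I m. P (j, e) * monomial I e c) \<noteq> 0"
    by (rule nonzero_polynomial_small_nonroot[where P = "\<lambda>e. P (j, e)", OF I finite_expo[OF I] _ je(2)])
      (use je \<kappa> in \<open>simp_all add: expo_def\<close>)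
  then obtain c where c: "\<forall>k\<in>I. 0 < c k \<and> c k < \<kappa>" "(\<Sum>e\<in>expo I m. P (j, e) * monomial I e c) \<noteq> 0"
    by (elim exE conjE)
  have "\<exists>z\<in>K i. \<forall>k\<in>I. f k z = c k" if "i < M" for i
    using sol[OF that] c(1) by blast
  then obtain z where z: "\<And>i. i < M \<Longrightarrow> z i \<in> K i" "\<And>i k. i < M \<Longrightarrow> k \<in> I \<Longrightarrow> f k (z i) = c k"
    by metis
  \<comment> \<open>At every \<open>z i\<close> the \<open>f k\<close> take the same values
    \<open>c\<close>, so the coefficients \<open>Q j\<close> are independent of \<open>i\<close>.
    Evaluating \<open>rel\<close> at the \<open>z i\<close> gives a homogeneous system with a matrix
    close to the identity.\<close>
  define Q where "Q i = (\<Sum>e\<in>expo I m. P (i, e) * monomial I e c)" for i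
  have "monomial I e (\<lambda>k. f k (z i)) = monomial I e c" if "i < M" for i e
    using z(2)[OF that] by (simp add: monomial_def)
  then have "(\<Sum>j<M. Q j * g j (z i)) = 0" if "i < M" for i
    using rel[of "z i"] that by (simp add: Q_def)
  moreover have "\<bar>g i (z j)\<bar> < 1 / real (2 * M)" if "i < M" "j < M" "i \<noteq> j" for i j
  proof -
    have "z j \<in> S" using z(1) that by (auto simp: S_def)
    then have "0 \<le> g i (z j)" using g_range that by blast
    then show ?thesis using g_off[of i j "z j"] z(1) that by (simp add: \<epsilon>_def)
  qed
  moreover have "g i (z i) > 1 - 1 / real (2 * M)" if "i < M" for i
    using g_diag[OF that z(1)[OF that]] by (simp add: \<epsilon>_def)
  ultimately have "Q j = 0"
    using near_identity_nonsingular[of M "\<lambda>i j. g i (z j)" Q j] je(1) by blast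
  then show False using c(2) by (simp add: Q_def)
qed

section \<open>Components of real zero sets\<close>

text \<open>At most one point from each component. Unlike the components, such sets can be lifted,
  split and thinned out.\<close>

definition pairwise_disconnected :: "'a::topological_space set \<Rightarrow> 'a set \<Rightarrow> bool" where
  "pairwise_disconnected X A \<longleftrightarrow> A \<subseteq> X \<and> (\<forall>a\<in>A. \<forall>b\<in>A. connected_component X a b \<longrightarrow> a = b)"

text \<open>In a compact Hausdorff space components are quasi-components, so points of different
  components are separated by a clopen set.\<close>

lemma compact_component_separation:
  fixes K :: "'a::metric_space set"
  assumes K: "compact K" and xy: "x \<in> K" "y \<in> K" "\<not> connected_component K x y"
  shows "\<exists>U V. closed U \<and> closed V \<and> U \<union> V = K \<and> U \<inter> V = {} \<and> x \<in> U \<and> y \<in> V"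
proof -
  let ?X = "top_of_set K"
  have "compact_space ?X" using K by (simp add: compact_space_subtopology)
  moreover have "Hausdorff_space ?X" by (simp add: Hausdorff_space_subtopology)
  ultimately have "quasi_component_of ?X x = connected_component_of ?X x"
    by (intro quasi_eq_connected_component_of) auto
  moreover have "\<not> connected_component_of ?X x y"
    using xy(3) by (auto simp: connected_component_of_def connected_component_def connectedin_subtopology)
  ultimately have "\<not> quasi_component_of ?X x y" by simp
  then obtain T where T: "closedin ?X T" "openin ?X T" "\<not> (x \<in> T \<longleftrightarrow> y \<in> T)"
    using xy by (auto simp: quasi_component_of_def)
  have "closedin ?X (K - T)" using T(2) closedin_diff[of ?X K T] closedin_topspace[of ?X] by simp
  then have "closed (K - T)" "closed T" "T \<subseteq> K"
    using T(1) K compact_imp_closed closedin_closed_trans closedin_subset by fastforce+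
  moreover from this have "T \<union> (K - T) = K" "(K - T) \<union> T = K" by auto
  ultimately show ?thesis using T(3) xy by (metis Diff_disjoint Diff_iff Int_commute)
qed

section \<open>Distances, compactness and lifting of point sets\<close>

lemma infdist_less_obtains:
  assumes "infdist z C < e" "C \<noteq> {}" obtains x where "x \<in> C" "dist z x < e"
proof -
  have "(INF a\<in>C. dist z a) < e" using assms by (simp add: infdist_notempty)
  then show ?thesis using that assms(2) by (subst (asm) cINF_less_iff) (auto intro: bdd_belowI2[of _ 0])
qed

lemma compact_disjoint_dist_pos:
  fixes C D :: "'a::metric_space set"
  assumes "compact C" "closed D" "C \<inter> D = {}"
  shows "\<exists>\<eta>>0. \<forall>x\<in>C. \<forall>y\<in>D. \<eta> \<le> dist x y"
proof (cases "C = {} \<or> D = {}")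
  case True
  then show ?thesis by (intro exI[of _ 1]) auto
next
  case False
  have "continuous_on C (\<lambda>x. infdist x D)" by (intro continuous_on_infdist continuous_on_id)
  then obtain x where x: "x \<in> C" "\<And>y. y \<in> C \<Longrightarrow> infdist x D \<le> infdist y D"
    using continuous_attains_inf[OF assms(1), of "\<lambda>x. infdist x D"] False by blast
  have "0 < infdist x D" using x(1) assms False by (intro infdist_pos_not_in_closed) auto
  moreover have "infdist x D \<le> dist y w" if "y \<in> C" "w \<in> D" for y w
    using x(2)[OF that(1)] infdist_le[OF that(2), of y] by linarith
  ultimately show ?thesis by blast
qed

lemma continuous_pos_on_compact_lower_bound:
  fixes F :: "'a::topological_space \<Rightarrow> real"
  assumes "compact K" "continuous_on K F" "\<And>x. x \<in> K \<Longrightarrow> 0 < F x"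
  shows "\<exists>\<delta>>0. \<forall>x\<in>K. \<delta> \<le> F x"
proof (cases "K = {}")
  case True
  then show ?thesis by (intro exI[of _ 1]) auto
next
  case False
  then show ?thesis using continuous_attains_inf[OF assms(1) False assms(2)] assms(3) by blast
qed

lemma finite_uniform_pos:
  fixes P :: "'a \<Rightarrow> real \<Rightarrow> bool"
  assumes "finite J" "\<And>j. j \<in> J \<Longrightarrow> \<exists>e>0. P j e"
    and mono: "\<And>j e e'. j \<in> J \<Longrightarrow> P j e \<Longrightarrow> 0 < e' \<Longrightarrow> e' \<le> e \<Longrightarrow> P j e'"
  shows "\<exists>e>0. \<forall>j\<in>J. P j e"
proof -
  obtain e where e: "\<And>j. j \<in> J \<Longrightarrow> 0 < e j \<and> P j (e j)" using assms(2) by metis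
  \<comment> \<open>The inserted 1 covers \<open>J = {}\<close>.\<close>
  let ?m = "Min (insert 1 (e ` J))"
  have m: "0 < ?m" using e assms(1) by (subst Min_gr_iff) auto
  moreover have "P j ?m" if "j \<in> J" for j
    using mono[OF that, of "e j" ?m] e[OF that] m that assms(1) by simp
  ultimately show ?thesis by blast
qed

text \<open>The function space may have infinitely many coordinates, so compactness comes from
  Tychonoff's theorem: the set is closed in a product of intervals and, outside \<open>I\<close>, of
  singletons.\<close>

lemma compact_support_ball:
  fixes I :: "'i::countable set"
  assumes "finite I"
  shows "compact {z :: 'i \<Rightarrow> real. (\<forall>i. i \<notin> I \<longrightarrow> z i = 0) \<and> (\<Sum>i\<in>I. (z i)\<^sup>2) \<le> R}"
proof -
  \<comment> \<open>The radius \<open>R + 1\<close> avoids a square root: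
    \<open>R \<le> (R + 1) ^ 2\<close> whenever \<open>0 \<le> R\<close>.\<close>
  define B where "B i = (if i \<in> I then {- (R + 1)..R + 1} else {0})" for i
  have "compactin (product_topology (\<lambda>i. euclidean) UNIV) (PiE UNIV B)"
    by (subst compactin_PiE) (simp add: B_def)
  then have compact: "compact (PiE UNIV B)" by (simp add: euclidean_product_topology)
  have closed: "closed {z :: 'i \<Rightarrow> real. (\<forall>i. i \<notin> I \<longrightarrow> z i = 0) \<and> (\<Sum>i\<in>I. (z i)\<^sup>2) \<le> R}"
    by (intro closed_Collect_conj closed_Collect_all closed_Collect_imp closed_Collect_eq closed_Collect_le
        open_Collect_const continuous_on_sum continuous_on_power continuous_on_const
        continuous_on_product_coordinates)
  have sub: "{z. (\<forall>i. i \<notin> I \<longrightarrow> z i = 0) \<and> (\<Sum>i\<in>I. (z i)\<^sup>2) \<le> R} \<subseteq> PiE UNIV B"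
  proof
    fix z assume "z \<in> {z :: 'i \<Rightarrow> real. (\<forall>i. i \<notin> I \<longrightarrow> z i = 0) \<and> (\<Sum>i\<in>I. (z i)\<^sup>2) \<le> R}"
    then have z: "\<And>i. i \<notin> I \<Longrightarrow> z i = 0" "(\<Sum>i\<in>I. (z i)\<^sup>2) \<le> R" by auto
    have "z i \<in> B i" for i
    proof (cases "i \<in> I")
      case True
      then have "(z i)\<^sup>2 \<le> (\<Sum>i\<in>I. (z i)\<^sup>2)" using assms by (intro member_le_sum) auto
      then have *: "(z i)\<^sup>2 \<le> R" using z(2) by linarith
      moreover have "0 \<le> (z i)\<^sup>2" by simp
      ultimately have "0 \<le> R" by linarith
      then have "(z i)\<^sup>2 \<le> (R + 1)\<^sup>2" using * by (simp add: power2_sum) (smt (verit) zero_le_power2)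
      then have "\<bar>z i\<bar> \<le> \<bar>R + 1\<bar>" by (simp only: abs_le_square_iff)
      then have "\<bar>z i\<bar> \<le> R + 1" using \<open>0 \<le> R\<close> by simp
      then show ?thesis using True by (simp add: B_def abs_le_iff)
    qed (simp add: z B_def)
    then show "z \<in> PiE UNIV B" by (auto simp: PiE_UNIV_domain)
  qed
  show ?thesis using compact_Int_closed[OF compact closed] unfolding Int_absorb1[OF sub] .
qed

lemma continuous_fun_upd: "continuous_on UNIV (\<lambda>t. (z :: 'i \<Rightarrow> real)(k := t))"
proof (rule continuous_on_coordinatewise_then_product)
  show "continuous_on UNIV (\<lambda>t. (z(k := t)) i)" for i by (cases "i = k") auto
qed

text \<open>A connected set joining two chosen preimages would be mapped to a connected set joining
  their images. Only the points of \<open>A\<close> have to be hit, so \<open>X'\<close> may encode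
  a smaller set than \<open>X\<close>.\<close>

lemma lift_pairwise_disconnected:
  assumes cont: "continuous_on X' f" and img: "f ` X' \<subseteq> X" and A: "pairwise_disconnected X A" "A \<subseteq> f ` X'"
    and fin: "finite A"
  shows "\<exists>A'\<subseteq>X'. finite A' \<and> pairwise_disconnected X' A' \<and> card A' = card A \<and> f ` A' = A"
proof -
  obtain A' where A': "A' \<subseteq> X'" "bij_betw f A' A"
    using A(2) by (metis subset_image_inj inj_on_imp_bij_betw)
  have "a = b" if ab: "a \<in> A'" "b \<in> A'" and con: "connected_component X' a b" for a b
  proof -
    obtain T where T: "connected T" "T \<subseteq> X'" "a \<in> T" "b \<in> T" using con by (auto simp: connected_component_def)
    have "connected (f ` T)" by (rule connected_continuous_image[OF continuous_on_subset[OF cont T(2)] T(1)])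
    moreover have "f ` T \<subseteq> X" "f a \<in> f ` T" "f b \<in> f ` T" using T img by auto
    ultimately have "connected_component X (f a) (f b)" by (rule connected_componentI)
    moreover have "f a \<in> A" "f b \<in> A" using A'(2) ab by (auto simp: bij_betw_def)
    ultimately have "f a = f b" using A(1) unfolding pairwise_disconnected_def by blast
    then show ?thesis using A'(2) ab by (auto simp: bij_betw_def inj_on_def)
  qed
  then have "pairwise_disconnected X' A'" using A'(1) by (auto simp: pairwise_disconnected_def)
  then show ?thesis
    using A' fin bij_betw_same_card[OF A'(2)] bij_betw_finite[OF A'(2)] bij_betw_imp_surj_on[OF A'(2)] by blast
qed

text \<open>
  Each clopen piece of the zero set, cut off by a large ball, is the set of minimum points of \<open>F\<close> in
  a compact neighbourhood.  Adding a small multiple of the squared norm keeps the minimum away from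
  the cut-off sphere, so that it survives small linear perturbations: every neighbourhood contains
  points with any prescribed small gradient.
\<close>

theorem zero_set_components_bound:
  fixes F :: "('i::countable \<Rightarrow> real) \<Rightarrow> real"
  assumes I: "finite I" and d: "0 < d" and F: "F \<in> polys I (Suc d)" and F_nonneg: "\<And>z. 0 \<le> F z"
    and A: "finite A" "pairwise_disconnected {z. (\<forall>i. i \<notin> I \<longrightarrow> z i = 0) \<and> F z = 0} A"
  shows "card A \<le> d ^ card I"
proof -
  define M where "M = card A"
  obtain a where "bij_betw a {0..<M} A" using ex_bij_betw_nat_finite[OF A(1)] by (auto simp: M_def)
  then have a_inj: "inj_on a {..<M}" and aA: "a ` {..<M} = A"
    by (auto simp: bij_betw_def atLeast0LessThan)
  define N where "N z = (\<Sum>i\<in>I. (z i)\<^sup>2)" for z :: "'i \<Rightarrow> real"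
  have N_nonneg: "0 \<le> N z" for z by (simp add: N_def sum_nonneg)
  define s where "s = (\<Sum>j<M. N (a j))"
  \<comment> \<open>The extra 1 places the \<open>a j\<close> strictly inside the ball; the penalty
    \<open>\<epsilon> * N\<close> is then lower by \<open>\<epsilon>\<close> at \<open>a j\<close>
    than on the sphere.\<close>
  define R where "R = 1 + s"
  have s: "0 \<le> s" "\<And>j. j < M \<Longrightarrow> N (a j) \<le> s"
    using N_nonneg by (auto simp: s_def sum_nonneg intro!: member_le_sum)
  have contF: "continuous_on X F" for X by (rule polys_continuous[OF F])
  have N_poly: "N \<in> polys I 2"
    using polys_sum[of I "\<lambda>i z. (z i)\<^sup>2" I 2] polys_power[OF I polys_var[OF I], of _ 1 2]
    by (simp add: N_def[abs_def])
  have contN: "continuous_on X N" for X by (rule polys_continuous[OF N_poly])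
  define B where "B = {z. (\<forall>i. i \<notin> I \<longrightarrow> z i = 0) \<and> N z \<le> R}"
  have B: "compact B" unfolding B_def N_def by (rule compact_support_ball[OF I])
  define V where "V = B \<inter> {z. F z = 0}"
  have V: "compact V"
    unfolding V_def by (intro compact_Int_closed B closed_Collect_eq contF continuous_on_const)
  have aV: "a j \<in> V" if "j < M" for j
  proof -
    have "a j \<in> A" using that aA by blast
    then show ?thesis using A(2) s(2)[OF that] by (auto simp: V_def B_def pairwise_disconnected_def R_def)
  qed
  have "\<not> connected_component V (a i) (a j)" if "i < M" "j < M" "i \<noteq> j" for i j
  proof
    assume "connected_component V (a i) (a j)"
    then have "connected_component {z. (\<forall>i. i \<notin> I \<longrightarrow> z i = 0) \<and> F z = 0} (a i) (a j)"
      by (rule connected_component_of_subset) (auto simp: V_def B_def)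
    moreover have "a i \<in> A" "a j \<in> A" using that aA by blast+
    ultimately have "a i = a j" using A(2) by (auto simp: pairwise_disconnected_def)
    then show False using a_inj that by (auto simp: inj_on_def)
  qed
  then have "\<exists>U W. closed U \<and> closed W \<and> U \<union> W = V \<and> U \<inter> W = {} \<and> a i \<in> U \<and> a j \<in> W"
    if "i < M" "j < M" "i \<noteq> j" for i j
    using compact_component_separation[OF V] aV that by metis
  then obtain U W where UW: "\<And>i j. i < M \<Longrightarrow> j < M \<Longrightarrow> i \<noteq> j \<Longrightarrow>
      closed (U i j) \<and> closed (W i j) \<and> U i j \<union> W i j = V \<and> U i j \<inter> W i j = {} \<and> a i \<in> U i j \<and> a j \<in> W i j"
    by metis
  \<comment> \<open>\<open>C i\<close> is the clopen piece of \<open>V\<close> around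
    \<open>a i\<close> and \<open>D i\<close> the rest of \<open>V\<close>. The separations chosen
    for \<open>(i, j)\<close> and for \<open>(j, i)\<close> are unrelated; both are used so that
    \<open>C j \<subseteq> D i\<close>.\<close>
  define D where "D i = (\<Union>j\<in>{..<M} - {i}. W i j \<union> U j i)" for i
  define C where "C i = V \<inter> (\<Inter>j\<in>{..<M} - {i}. U i j \<inter> W j i)" for i
  have D: "closed (D i)" if "i < M" for i
    unfolding D_def using UW that by (intro closed_UN ballI closed_Un) auto
  have C: "compact (C i)" if "i < M" for i
    unfolding C_def using UW that by (intro compact_Int_closed V closed_INT ballI closed_Int) auto
  have CD: "C i \<union> D i = V" "C i \<inter> D i = {}" "a i \<in> C i" if "i < M" for i
    using UW[OF that] UW[OF _ that] aV[OF that] unfolding C_def D_def by blast+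
  have CsubD: "C j \<subseteq> D i" if "i < M" "j < M" "i \<noteq> j" for i j
    using that unfolding C_def D_def by blast
  obtain \<eta> where \<eta>: "0 < \<eta>" "\<And>i x y. i < M \<Longrightarrow> x \<in> C i \<Longrightarrow> y \<in> D i \<Longrightarrow> \<eta> \<le> dist x y"
    using finite_uniform_pos[of "{..<M}" "\<lambda>i \<eta>. \<forall>x\<in>C i. \<forall>y\<in>D i. \<eta> \<le> dist x y"]
      compact_disjoint_dist_pos[OF C D CD(2)] by fastforce
  define h where "h i z = infdist z (C i)" for i z
  have conth: "continuous_on X (h i)" for X i
    unfolding h_def by (intro continuous_on_infdist continuous_on_id)
  \<comment> \<open>The radius is below \<open>\<eta> / 2\<close>: the \<open>K i\<close> are
    disjoint, and the zeros of \<open>F\<close> in \<open>K i\<close> all lie in \<open>C i\<close>,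
    so that \<open>F\<close> is positive where \<open>h i z = \<eta> / 3\<close>.\<close>
  define K where "K i = B \<inter> {z. h i z \<le> \<eta> / 3}" for i
  have K: "compact (K i)" for i
    unfolding K_def by (intro compact_Int_closed B closed_Collect_le conth continuous_on_const)
  have near: "\<exists>x\<in>C i. dist z x < \<eta> / 2" if "i < M" "z \<in> K i" for i z
  proof -
    have "infdist z (C i) < \<eta> / 2" using that(2) \<eta>(1) by (simp add: K_def h_def)
    moreover have "C i \<noteq> {}" using CD(3)[OF that(1)] by blast
    ultimately show ?thesis by (meson infdist_less_obtains)
  qed
  have disj: "K i \<inter> K j = {}" if ij: "i < M" "j < M" "i \<noteq> j" for i j
  proof (rule ccontr)
    assume "K i \<inter> K j \<noteq> {}"
    then obtain z where z: "z \<in> K i" "z \<in> K j" by blast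
    obtain x y where "x \<in> C i" "dist z x < \<eta> / 2" "y \<in> C j" "dist z y < \<eta> / 2"
      using near[OF ij(1) z(1)] near[OF ij(2) z(2)] by blast
    moreover from this have "\<eta> \<le> dist x y" using \<eta>(2)[OF ij(1)] CsubD[OF ij] by blast
    ultimately show False using dist_triangle3[of x y z] by linarith
  qed
  have zeroC: "z \<in> C i" if i: "i < M" and z: "z \<in> K i" "F z = 0" for i z
  proof (rule ccontr)
    assume "z \<notin> C i"
    then have "z \<in> D i" using i z CD(1) by (auto simp: K_def V_def)
    moreover obtain x where "x \<in> C i" "dist z x < \<eta> / 2" using near[OF i z(1)] by blast
    ultimately show False using \<eta>(2)[OF i, of x z] \<eta>(1) by (simp add: dist_commute)
  qed
  have "\<exists>\<delta>>0. \<forall>z\<in>K i \<inter> {z. h i z = \<eta> / 3}. \<delta> \<le> F z" if "i < M" for i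
  proof (rule continuous_pos_on_compact_lower_bound)
    show "compact (K i \<inter> {z. h i z = \<eta> / 3})"
      by (intro compact_Int_closed K closed_Collect_eq conth continuous_on_const)
    fix z assume z: "z \<in> K i \<inter> {z. h i z = \<eta> / 3}"
    then have "F z \<noteq> 0" using zeroC[OF that, of z] \<eta>(1) by (auto simp: h_def)
    then show "0 < F z" using F_nonneg[of z] by linarith
  qed (rule contF)
  then have "\<exists>\<delta>>0. \<forall>i\<in>{..<M}. \<forall>z\<in>K i \<inter> {z. h i z = \<eta> / 3}. \<delta> \<le> F z"
    by (intro finite_uniform_pos[of "{..<M}"]) (simp, simp, meson order_trans)
  then obtain \<delta> where \<delta>: "0 < \<delta>" "\<And>i z. i < M \<Longrightarrow> z \<in> K i \<Longrightarrow> h i z = \<eta> / 3 \<Longrightarrow> \<delta> \<le> F z"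
    by auto
  \<comment> \<open>On \<open>B\<close> the penalty is at most \<open>\<delta> / 2\<close>, and
    \<open>\<kappa>\<close> will keep the linear term within \<open>\<epsilon> / 3\<close>. The
    value of \<open>G\<close> at \<open>a j\<close> is at most
    \<open>\<epsilon> * R - \<epsilon>\<close>; two errors of \<open>\<epsilon> / 3\<close> still
    leave \<open>G < \<epsilon> * R\<close> at a minimum point of \<open>H\<close>, which excludes
    both the sphere and the lateral boundary.\<close>
  define \<epsilon> where "\<epsilon> = \<delta> / (2 * R)"
  have R: "1 \<le> R" using s(1) by (simp add: R_def)
  have \<epsilon>: "0 < \<epsilon>" "\<epsilon> * R = \<delta> / 2" using R \<delta>(1) by (auto simp: \<epsilon>_def)
  define \<kappa> where "\<kappa> = \<epsilon> / (3 * (real (card I) + R))"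
  have \<kappa>: "0 < \<kappa>" "\<kappa> * (real (card I) + R) = \<epsilon> / 3" using R \<epsilon>(1) by (auto simp: \<kappa>_def field_simps)
  define G where "G z = F z + \<epsilon> * N z" for z
  have "N \<in> polys I (Suc d)" using N_poly polys_mono[OF I, of 2 "Suc d"] d by auto
  then have G_poly: "G \<in> polys I (Suc d)"
    unfolding G_def[abs_def] by (intro polys_add F polys_cmult)
  have "\<forall>k\<in>I. \<exists>g. g \<in> polys I d \<and> (\<forall>z. ((\<lambda>t. G (z(k := t))) has_real_derivative g z) (at (z k)))"
    using polys_partial_derivative[OF I _ G_poly] by blast
  from bchoice[OF this] obtain g where g: "\<forall>k\<in>I. g k \<in> polys I d \<and>
      (\<forall>z. ((\<lambda>t. G (z(k := t))) has_real_derivative g k z) (at (z k)))" ..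
  have sol: "\<exists>z\<in>K j. \<forall>k\<in>I. g k z = c k"
    if j: "j < M" and c: "\<And>k. k \<in> I \<Longrightarrow> 0 < c k \<and> c k < \<kappa>" for c j
  proof -
    define L where "L z = (\<Sum>k\<in>I. c k * z k)" for z
    have L_bound: "\<bar>L z\<bar> \<le> \<epsilon> / 3" if "z \<in> B" for z
    proof -
      have "\<bar>L z\<bar> \<le> (\<Sum>k\<in>I. \<bar>c k * z k\<bar>)" unfolding L_def by (rule sum_abs)
      also have "\<dots> \<le> (\<Sum>k\<in>I. \<kappa> * (1 + (z k)\<^sup>2))"
      proof (rule sum_mono)
        fix k assume "k \<in> I"
        have "0 \<le> (\<bar>z k\<bar> - 1)\<^sup>2" "0 \<le> (z k)\<^sup>2" by simp_all
        then have "\<bar>z k\<bar> \<le> 1 + (z k)\<^sup>2" unfolding power2_diff by simp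
        then show "\<bar>c k * z k\<bar> \<le> \<kappa> * (1 + (z k)\<^sup>2)"
          using c[OF \<open>k \<in> I\<close>] unfolding abs_mult by (intro mult_mono) auto
      qed
      also have "\<dots> = \<kappa> * (real (card I) + N z)" by (simp add: N_def sum_distrib_left[symmetric] sum.distrib)
      also have "\<dots> \<le> \<epsilon> / 3" unfolding \<kappa>(2)[symmetric] using that \<kappa>(1) by (simp add: B_def)
      finally show ?thesis .
    qed
    define H where "H z = G z - L z" for z
    have "L \<in> polys I 1" unfolding L_def by (intro polys_sum polys_cmult polys_var I) auto
    then have contH: "continuous_on (K j) H"
      unfolding H_def[abs_def] by (intro continuous_on_diff polys_continuous[OF G_poly] polys_continuous)
    have aK: "a j \<in> K j" using aV[OF j] CD(3)[OF j] \<eta>(1) by (simp add: K_def V_def h_def)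
    then obtain z where z: "z \<in> K j" and z_min: "\<And>y. y \<in> K j \<Longrightarrow> H z \<le> H y"
      using continuous_attains_inf[OF K _ contH] by blast
    have zB: "z \<in> B" and aB: "a j \<in> B" using z aK by (auto simp: K_def)
    have "F (a j) = 0" using aV[OF j] by (simp add: V_def)
    then have "G (a j) \<le> \<epsilon> * R - \<epsilon>"
      using s(2)[OF j] \<epsilon>(1) by (simp add: G_def R_def distrib_left)
    then have "H z < \<epsilon> * R - \<epsilon> / 3"
      using z_min[OF aK] L_bound[OF aB] \<epsilon>(1) unfolding H_def by linarith
    then have Gz: "G z < \<epsilon> * R" using L_bound[OF zB] unfolding H_def by linarith
    have "N z < R"
    proof -
      have "\<epsilon> * N z < \<epsilon> * R" using Gz F_nonneg[of z] unfolding G_def by linarith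
      then show ?thesis using \<epsilon>(1) by simp
    qed
    moreover have "h j z < \<eta> / 3"
    proof (rule ccontr)
      assume "\<not> ?thesis"
      then have "h j z = \<eta> / 3" using z by (simp add: K_def)
      then have "\<delta> \<le> F z" using \<delta>(2)[OF j z] by blast
      moreover have "0 \<le> \<epsilon> * N z" using \<epsilon>(1) N_nonneg by simp
      ultimately show False using Gz \<epsilon>(2) \<delta>(1) unfolding G_def by linarith
    qed
    ultimately have z_in: "z \<in> {y. N y < R \<and> h j y < \<eta> / 3}" by simp
    have open_in: "open {y. N y < R \<and> h j y < \<eta> / 3}"
      by (intro open_Collect_conj open_Collect_less contN conth continuous_on_const)
    \<comment> \<open>The minimum point is off both boundaries, so moving one coordinate slightly
      stays in \<open>K j\<close>, and the partial derivatives of \<open>H = G - L\<close> vanish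
      there.\<close>
    have "g k z = c k" if k: "k \<in> I" for k
    proof -
      have "open ((\<lambda>t. z(k := t)) -` {y. N y < R \<and> h j y < \<eta> / 3})"
        by (rule open_vimage[OF open_in continuous_fun_upd])
      moreover have "z k \<in> (\<lambda>t. z(k := t)) -` {y. N y < R \<and> h j y < \<eta> / 3}" using z_in by simp
      ultimately obtain \<rho> where \<rho>: "0 < \<rho>"
        "ball (z k) \<rho> \<subseteq> (\<lambda>t. z(k := t)) -` {y. N y < R \<and> h j y < \<eta> / 3}"
        by (meson open_contains_ball)
      have "H (z(k := z k)) \<le> H (z(k := t))" if "\<bar>z k - t\<bar> < \<rho>" for t
      proof -
        have "t \<in> ball (z k) \<rho>" using that by (simp add: dist_real_def)
        then have "z(k := t) \<in> {y. N y < R \<and> h j y < \<eta> / 3}" using \<rho>(2) by blast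
        moreover have "\<forall>i. i \<notin> I \<longrightarrow> (z(k := t)) i = 0" using zB k by (auto simp: B_def)
        ultimately have "z(k := t) \<in> K j" by (simp add: K_def B_def)
        then show ?thesis using z_min by simp
      qed
      then have loc: "\<forall>t. \<bar>z k - t\<bar> < \<rho> \<longrightarrow> H (z(k := z k)) \<le> H (z(k := t))" by blast
      have "L (z(k := t)) = c k * t + (\<Sum>i\<in>I - {k}. c i * z i)" for t
        unfolding L_def sum.remove[OF I k] by (auto intro!: sum.cong)
      then have "((\<lambda>t. L (z(k := t))) has_real_derivative c k) (at (z k))"
        by (auto intro!: derivative_eq_intros)
      then have "((\<lambda>t. H (z(k := t))) has_real_derivative g k z - c k) (at (z k))"
        unfolding H_def using g k by (intro DERIV_diff) auto
      from DERIV_local_min[OF this \<rho>(1) loc] show ?thesis by simp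
    qed
    then show ?thesis using z by blast
  qed
  have "M \<le> d ^ card I"
  proof (rule stable_solutions_bound[OF I d _ K disj _ \<kappa>(1) sol])
    show "g k \<in> polys I d" if "k \<in> I" for k using g that by blast
    show "z i = 0" if "z \<in> K j" "i \<notin> I" for z i j using that by (auto simp: K_def B_def)
  qed
  then show ?thesis by (simp add: M_def)
qed

section \<open>Quadratic encoding of computation trees\<close>

lemma polys_subset:
  assumes J: "finite J" and IJ: "I \<subseteq> J" shows "polys I d \<subseteq> polys J d"
proof
  fix f assume "f \<in> polys I d"
  then obtain c where f: "f = (\<lambda>z. \<Sum>e\<in>expo I d. c e * monomial I e z)" by (auto simp: polys_def)
  have "monomial I e \<in> polys J d" if "e \<in> expo I d" for e
  proof -
    have supp: "\<And>i. i \<notin> I \<Longrightarrow> e i = 0" using that by (simp add: expo_def)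
    have "monomial I e z = monomial J e z" for z
      unfolding monomial_def using supp by (intro prod.mono_neutral_left J IJ) auto
    then have "monomial I e = monomial J e" by blast
    moreover have "sum e I = sum e J" using supp by (intro sum.mono_neutral_left J IJ) auto
    then have "e \<in> expo J d" using that IJ by (auto simp: expo_def)
    ultimately show ?thesis using monomial_polys[OF J] by simp
  qed
  then show "f \<in> polys J d" unfolding f by (intro polys_sum polys_cmult) 
qed

lemma polys_cong:
  assumes "f \<in> polys I d" "\<And>i. i \<in> I \<Longrightarrow> z i = z' i" shows "f z = f z'"
proof -
  have "monomial I e z = monomial I e z'" for e
    unfolding monomial_def using assms(2) by (intro prod.cong) auto
  then show ?thesis using assms(1) by (auto simp: polys_def)
qed

lemma polys_var_mult:
  assumes "finite I" "i \<in> I" "j \<in> I" shows "(\<lambda>z. z i * z j) \<in> polys I 2"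
proof -
  have "(\<lambda>z. z i * z j) \<in> polys I (1 + 1)" using assms by (intro polys_mult polys_var) auto
  then show ?thesis by (simp add: numeral_2_eq_2)
qed

text \<open>The number is the time left. A leaf decides at any time since \<open>Top\<close> and
  \<open>Bot\<close> are absorbing; an internal vertex at time 0, or an operation outside its
  domain, means that \<open>Top\<close> is not reached.\<close>

fun accepts :: "nat \<Rightarrow> act \<Rightarrow> (nat \<Rightarrow> real) \<Rightarrow> bool" where
  "accepts k (Leaf b) x \<longleftrightarrow> b"
| "accepts 0 (Compute v p t) x \<longleftrightarrow> False"
| "accepts 0 (Test v i r t u) x \<longleftrightarrow> False"
| "accepts (Suc k) (Compute v p t) x \<longleftrightarrow> x \<in> operation_dom p \<and> accepts k t (x(v := operation_val p x))"
| "accepts (Suc k) (Test v i r t u) x \<longleftrightarrow> (if holds_zero r (x i) then accepts k t x else accepts k u x)"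

text \<open>
  A computation vertex costs two auxiliary variables, its value and one slack variable, and a test
  vertex one slack variable; with gradients of degree 3 each variable costs a factor 3.
\<close>

fun component_bound :: "nat \<Rightarrow> act \<Rightarrow> nat" where
  "component_bound k (Leaf b) = of_bool b"
| "component_bound 0 (Compute v p t) = 0"
| "component_bound 0 (Test v i r t u) = 0"
| "component_bound (Suc k) (Compute v p t) = 9 * component_bound k t"
| "component_bound (Suc k) (Test v i r t u) = 3 * (component_bound k t + component_bound k u)"

text \<open>One quadratic equation with one slack variable per outcome, such as
  \<open>y - u ^ 2 - m = 0\<close> for \<open>y > 0\<close> and \<open>y * u - 1 = 0\<close> for
  \<open>y \<noteq> 0\<close>. Soundness holds for all \<open>y\<close>, solvability only on
  \<open>Y\<close>, whose finiteness supplies the margin \<open>m\<close>.\<close>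

lemma test_encoding:
  assumes "finite Y" "\<And>y. y \<in> Y \<Longrightarrow> holds_zero r y \<longleftrightarrow> s"
  shows "\<exists>a b c e. (\<forall>y u. a * y + b * (y * u) + c * u\<^sup>2 + e = 0 \<longrightarrow> (holds_zero r y \<longleftrightarrow> s)) \<and>
    (\<forall>y\<in>Y. \<exists>u. a * y + b * (y * u) + c * u\<^sup>2 + e = 0)"
proof -
  have margin: "\<exists>m>0. \<forall>y\<in>Y. m \<le> \<bar>y\<bar>" if "\<forall>y\<in>Y. y \<noteq> 0"
  proof (rule finite_uniform_pos[OF assms(1)])
    show "\<exists>m>0. m \<le> \<bar>y\<bar>" if "y \<in> Y" for y
      using that \<open>\<forall>y\<in>Y. y \<noteq> 0\<close> by (intro exI[of _ "\<bar>y\<bar>"]) simp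
  qed simp
  show ?thesis
  proof (cases r; cases s)
    assume rs: "r = Greater" "s"
    then have Y: "y > 0" if "y \<in> Y" for y using assms(2)[OF that] by simp
    then obtain m where m: "m > 0" "\<forall>y\<in>Y. m \<le> \<bar>y\<bar>" using margin by force
    have "\<exists>u. 1 * y + 0 * (y * u) + (-1) * u\<^sup>2 + (- m) = 0" if "y \<in> Y" for y
      using m(2) Y[OF that] that by (intro exI[of _ "sqrt (y - m)"]) force
    moreover have "y > 0" if "1 * y + 0 * (y * u) + (-1) * u\<^sup>2 + (- m) = 0" for y u :: real
      using that m(1) zero_le_power2[of u] by linarith
    ultimately show ?thesis using rs by (intro exI[of _ 1] exI[of _ 0] exI[of _ "-1"] exI[of _ "- m"]) simp
  next
    assume rs: "r = Greater" "\<not> s"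
    then have Y: "y \<le> 0" if "y \<in> Y" for y using assms(2)[OF that] by simp
    have "\<exists>u. 1 * y + 0 * (y * u) + 1 * u\<^sup>2 + 0 = 0" if "y \<in> Y" for y
      using Y[OF that] by (intro exI[of _ "sqrt (- y)"]) simp
    moreover have "y \<le> 0" if "1 * y + 0 * (y * u) + 1 * u\<^sup>2 + 0 = 0" for y u :: real
      using that zero_le_power2[of u] by linarith
    ultimately show ?thesis using rs by (intro exI[of _ 1] exI[of _ 0] exI[of _ 1] exI[of _ 0]) (simp add: not_less)
  next
    assume rs: "r = Equal" "s"
    then show ?thesis using assms(2) by (intro exI[of _ 1] exI[of _ 0] exI[of _ 0] exI[of _ 0]) simp
  next
    assume rs: "r = Equal" "\<not> s"
    have "\<exists>u. 0 * y + 1 * (y * u) + 0 * u\<^sup>2 + (-1) = 0" if "y \<in> Y" for y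
      using rs assms(2)[OF that] by (intro exI[of _ "1 / y"]) simp
    moreover have "y \<noteq> 0" if "0 * y + 1 * (y * u) + 0 * u\<^sup>2 + (-1) = 0" for y u :: real
      using that by auto
    ultimately show ?thesis using rs by (intro exI[of _ 0] exI[of _ 1] exI[of _ 0] exI[of _ "-1"]) simp
  next
    assume rs: "r = GreaterEq" "s"
    then have Y: "y \<ge> 0" if "y \<in> Y" for y using assms(2)[OF that] by simp
    have "\<exists>u. 1 * y + 0 * (y * u) + (-1) * u\<^sup>2 + 0 = 0" if "y \<in> Y" for y
      using Y[OF that] by (intro exI[of _ "sqrt y"]) simp
    moreover have "y \<ge> 0" if "1 * y + 0 * (y * u) + (-1) * u\<^sup>2 + 0 = 0" for y u :: real
      using that zero_le_power2[of u] by linarith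
    ultimately show ?thesis using rs by (intro exI[of _ 1] exI[of _ 0] exI[of _ "-1"] exI[of _ 0]) simp
  next
    assume rs: "r = GreaterEq" "\<not> s"
    then have Y: "y < 0" if "y \<in> Y" for y using assms(2)[OF that] by simp
    then obtain m where m: "m > 0" "\<forall>y\<in>Y. m \<le> \<bar>y\<bar>" using margin by force
    have "\<exists>u. 1 * y + 0 * (y * u) + 1 * u\<^sup>2 + m = 0" if "y \<in> Y" for y
      using m(2) Y[OF that] that by (intro exI[of _ "sqrt (- y - m)"]) force
    moreover have "y < 0" if "1 * y + 0 * (y * u) + 1 * u\<^sup>2 + m = 0" for y u :: real
      using that m(1) zero_le_power2[of u] by linarith
    ultimately show ?thesis using rs by (intro exI[of _ 1] exI[of _ 0] exI[of _ 1] exI[of _ m]) (simp add: not_le)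
  qed
qed

text \<open>Register \<open>i\<close> is kept in coordinate \<open>2 * i\<close>; the odd coordinates hold slack variables.\<close>

definition registers :: "(nat \<Rightarrow> real) \<Rightarrow> nat \<Rightarrow> real" where
  "registers z = (\<lambda>i. z (2 * i))"

lemma registers_apply: "registers z i = z (2 * i)"
  by (simp add: registers_def)

lemma operation_cong:
  assumes "\<And>i. i \<in> operands p \<Longrightarrow> x i = y i"
  shows "x \<in> operation_dom p \<longleftrightarrow> y \<in> operation_dom p" "operation_val p x = operation_val p y"
  using assms by (cases p; auto)+

text \<open>The slack variable is the inverse of the divisor in a division, and for
  \<open>Sqrt\<close> the square root of the result: \<open>y = u ^ 2\<close> forces
  \<open>0 \<le> y\<close>, after which \<open>x = y ^ 2\<close> determines \<open>y\<close>. In the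
  other cases it is free and the second equation is trivial.\<close>

lemma operation_encoding:
  assumes I: "finite I" "2 * v \<in> I" "Suc (2 * v) \<in> I" "(\<lambda>i. 2 * i) ` operands p \<subseteq> I" and v: "v \<notin> operands p"
  shows "\<exists>q q'. q \<in> polys I 2 \<and> q' \<in> polys I 2 \<and>
    (\<forall>z. q z = 0 \<and> q' z = 0 \<longrightarrow> registers z \<in> operation_dom p \<and> z (2 * v) = operation_val p (registers z)) \<and>
    (\<forall>z. registers z \<in> operation_dom p \<longrightarrow>
      (\<exists>u. q (z(2 * v := operation_val p (registers z), Suc (2 * v) := u)) = 0 \<and>
           q' (z(2 * v := operation_val p (registers z), Suc (2 * v) := u)) = 0))"
    (is "\<exists>q q'. ?enc q q'")
proof -
  let ?y = "2 * v" and ?u = "Suc (2 * v)"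
  have odd: "2 * i \<noteq> Suc (2 * v)" for i by presburger
  have lin: "(\<lambda>z. z m) \<in> polys I 2" if "m \<in> I" for m using polys_var[OF I(1) that] by simp
  have diff: "(\<lambda>z. f z - g z) \<in> polys I 2" if "f \<in> polys I 2" "g \<in> polys I 2" for f g
    using polys_add[OF that(1) polys_cmult[OF that(2), of "-1"]] by simp
  note poly = diff polys_add polys_cmult lin polys_var_mult polys_const[OF I(1)] I
  have div: "?enc (\<lambda>z. z (2 * j) * z ?u - 1) (\<lambda>z. z ?y - num z * z ?u)"
    if j: "j \<noteq> v" "2 * j \<in> I" and num: "(\<lambda>z. num z * z ?u) \<in> polys I 2"
      "\<And>z a b. num (z(?y := a, ?u := b)) = num z"
      and p: "\<And>x. x \<in> operation_dom p \<longleftrightarrow> x j \<noteq> 0" "\<And>z. operation_val p (registers z) = num z / z (2 * j)"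
    for j num
  proof (intro conjI allI impI)
    fix z :: "nat \<Rightarrow> real" assume "z (2 * j) * z ?u - 1 = 0 \<and> z ?y - num z * z ?u = 0"
    then have "z (2 * j) \<noteq> 0" "z ?u = 1 / z (2 * j)" "z ?y = num z * z ?u" by (auto simp: eq_divide_eq mult.commute)
    then show "registers z \<in> operation_dom p" "z ?y = operation_val p (registers z)"
      by (simp_all add: p registers_apply)
  next
    fix z assume "registers z \<in> operation_dom p"
    then have "z (2 * j) \<noteq> 0" by (simp add: p registers_apply)
    then show "\<exists>u. (z(?y := operation_val p (registers z), ?u := u)) (2 * j) *
          (z(?y := operation_val p (registers z), ?u := u)) ?u - 1 = 0 \<and>
        (z(?y := operation_val p (registers z), ?u := u)) ?y -
          num (z(?y := operation_val p (registers z), ?u := u)) * (z(?y := operation_val p (registers z), ?u := u)) ?u = 0"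
      unfolding num(2) using j odd by (intro exI[of _ "1 / z (2 * j)"]) (simp add: p)
  qed (intro poly j num)+
  show ?thesis
  proof (cases p)
    case (Binary i a j)
    then have ij: "i \<noteq> v" "j \<noteq> v" "2 * i \<in> I" "2 * j \<in> I" using v I(4) by auto
    show ?thesis
    proof (cases a)
      case Add
      have "?enc (\<lambda>z. z ?y - (z (2 * i) + z (2 * j))) (\<lambda>z. 0)"
        using Binary Add ij odd by (auto simp: registers_def intro!: poly)
      then show ?thesis by blast
    next
      case Sub
      have "?enc (\<lambda>z. z ?y - (z (2 * i) - z (2 * j))) (\<lambda>z. 0)"
        using Binary Sub ij odd by (auto simp: registers_def intro!: poly)
      then show ?thesis by blast
    next
      case Mul
      have "?enc (\<lambda>z. z ?y - z (2 * i) * z (2 * j)) (\<lambda>z. 0)"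
        using Binary Mul ij odd by (auto simp: registers_def intro!: poly)
      then show ?thesis by blast
    next
      case Div
      have "?enc (\<lambda>z. z (2 * j) * z ?u - 1) (\<lambda>z. z ?y - z (2 * i) * z ?u)"
        using Binary Div ij odd by (intro div) (auto simp: registers_def intro!: polys_var_mult I)
      then show ?thesis by blast
    qed
  next
    case (Scalar c a j)
    then have ij: "j \<noteq> v" "2 * j \<in> I" using v I(4) by auto
    show ?thesis
    proof (cases a)
      case Add
      have "?enc (\<lambda>z. z ?y - (c + z (2 * j))) (\<lambda>z. 0)"
        using Scalar Add ij odd by (auto simp: registers_def intro!: poly)
      then show ?thesis by blast
    next
      case Sub
      have "?enc (\<lambda>z. z ?y - (c - z (2 * j))) (\<lambda>z. 0)"
        using Scalar Sub ij odd by (auto simp: registers_def intro!: poly)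
      then show ?thesis by blast
    next
      case Mul
      have "?enc (\<lambda>z. z ?y - c * z (2 * j)) (\<lambda>z. 0)"
        using Scalar Mul ij odd by (auto simp: registers_def intro!: poly)
      then show ?thesis by blast
    next
      case Div
      have "?enc (\<lambda>z. z (2 * j) * z ?u - 1) (\<lambda>z. z ?y - c * z ?u)"
        using Scalar Div ij odd by (intro div) (auto simp: registers_def intro!: polys_cmult lin I)
      then show ?thesis by blast
    qed
  next
    case (Sqrt i)
    then have ij: "i \<noteq> v" "2 * i \<in> I" using v I(4) by auto
    have "?enc (\<lambda>z. z ?y - z ?u * z ?u) (\<lambda>z. z (2 * i) - z ?y * z ?y)"
    proof (intro conjI allI impI)
      fix z :: "nat \<Rightarrow> real" assume "z ?y - z ?u * z ?u = 0 \<and> z (2 * i) - z ?y * z ?y = 0"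
      then have "z (2 * i) = (z ?y)\<^sup>2" "0 \<le> z ?y" by (auto simp: power2_eq_square)
      then show "registers z \<in> operation_dom p" "z ?y = operation_val p (registers z)"
        using Sqrt by (auto simp: registers_def)
    next
      fix z assume "registers z \<in> operation_dom p"
      then have "0 \<le> z (2 * i)" using Sqrt by (simp add: registers_def)
      then show "\<exists>u. (z(?y := operation_val p (registers z), ?u := u)) ?y
            - (z(?y := operation_val p (registers z), ?u := u)) ?u * (z(?y := operation_val p (registers z), ?u := u)) ?u = 0 \<and>
          (z(?y := operation_val p (registers z), ?u := u)) (2 * i)
            - (z(?y := operation_val p (registers z), ?u := u)) ?y * (z(?y := operation_val p (registers z), ?u := u)) ?y = 0"
        using Sqrt ij odd by (intro exI[of _ "sqrt (sqrt (z (2 * i)))"]) (simp add: registers_def)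
    qed (use ij in \<open>auto intro!: poly\<close>)
    then show ?thesis by blast
  qed
qed

definition zero_set :: "'i set \<Rightarrow> (('i \<Rightarrow> real) \<Rightarrow> real) \<Rightarrow> ('i \<Rightarrow> real) set" where
  "zero_set I F = {z. (\<forall>i. i \<notin> I \<longrightarrow> z i = 0) \<and> F z = 0}"

text \<open>The projection that drops auxiliary coordinates, resetting them to 0 because points of
  \<open>zero_set I F\<close> vanish outside \<open>I\<close>.\<close>

definition forget :: "'i set \<Rightarrow> ('i \<Rightarrow> real) \<Rightarrow> 'i \<Rightarrow> real" where
  "forget J z = (\<lambda>i. if i \<in> J then 0 else z i)"

lemma continuous_forget: "continuous_on S (forget J)"
  unfolding forget_def[abs_def]
proof (rule continuous_on_coordinatewise_then_product)
  fix i show "continuous_on S (\<lambda>z. if i \<in> J then 0 else z i)"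
    using continuous_on_subset[OF continuous_on_product_coordinates subset_UNIV] by (cases "i \<in> J") auto
qed

lemma zero_set_forget:
  assumes F: "F \<in> polys I d" "\<And>z. 0 \<le> F z" and J: "J \<inter> I = {}"
    and z: "z \<in> zero_set (I \<union> J) (\<lambda>z. F z + ((q z)\<^sup>2 + (q' z)\<^sup>2))"
  shows "forget J z \<in> zero_set I F" "q z = 0" "q' z = 0"
proof -
  have "F z + ((q z)\<^sup>2 + (q' z)\<^sup>2) = 0" using z by (simp add: zero_set_def)
  moreover have "0 \<le> F z" "0 \<le> (q z)\<^sup>2" "0 \<le> (q' z)\<^sup>2" using F(2) by simp_all
  ultimately have 0: "F z = 0" "(q z)\<^sup>2 = 0" "(q' z)\<^sup>2 = 0" by linarith+
  then show "q z = 0" "q' z = 0" by simp_all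
  have "F (forget J z) = F z" using J by (intro polys_cong[OF F(1)]) (auto simp: forget_def)
  then show "forget J z \<in> zero_set I F" using 0 z by (auto simp: zero_set_def forget_def)
qed

lemma sum_squares_polys:
  assumes I: "finite I" "finite J" and F: "F \<in> polys I 4" and q: "q \<in> polys (I \<union> J) 2" "q' \<in> polys (I \<union> J) 2"
  shows "(\<lambda>z. F z + ((q z)\<^sup>2 + (q' z)\<^sup>2)) \<in> polys (I \<union> J) 4"
proof -
  have "finite (I \<union> J)" using I by simp
  from polys_power[OF this q(1), of 2] polys_power[OF this q(2), of 2] polys_subset[OF this, of I 4] F
  show ?thesis by (auto intro!: polys_add)
qed

text \<open>Induction down the tree, \<open>F\<close> collecting the squared equations of the path
  so far. A computation lifts \<open>A\<close> to two fresh coordinates; a test splits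
  \<open>A\<close> by outcome and lifts each half to one. At a leaf the zero set bound applies with
  \<open>d = 3\<close>, the degree of the gradient of \<open>F\<close>.\<close>

lemma accepts_components_bound:
  assumes "finite I" "F \<in> polys I 4" "\<And>z. 0 \<le> F z" "(\<lambda>i. 2 * i) ` S \<subseteq> I" "refs_ok S t"
    "distinct (vertices t)" "set (vertices t) \<inter> S = {}"
    "\<And>v. v \<in> set (vertices t) \<Longrightarrow> 2 * v \<notin> I \<and> Suc (2 * v) \<notin> I"
    "finite A" "pairwise_disconnected {z \<in> zero_set I F. accepts k t (registers z)} A"
  shows "card A \<le> component_bound k t * 3 ^ card I"
  using assms
proof (induction t arbitrary: k I F S A)
  case (Leaf b)
  show ?case
  proof (cases b)
    case True
    have F: "F \<in> polys I (Suc 3)" using Leaf.prems(2) by simp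
    have "pairwise_disconnected {z. (\<forall>i. i \<notin> I \<longrightarrow> z i = 0) \<and> F z = 0} A"
      using Leaf.prems(10) True by (simp add: zero_set_def)
    then show ?thesis
      using zero_set_components_bound[OF Leaf.prems(1) _ F Leaf.prems(3,9)] True by simp
  next
    case False
    then have "A = {}" using Leaf.prems(10) by (auto simp: pairwise_disconnected_def)
    then show ?thesis by simp
  qed
next
  case (Compute v p t)
  show ?case
  proof (cases k)
    case 0
    then have "A = {}" using Compute.prems(10) by (auto simp: pairwise_disconnected_def)
    then show ?thesis by simp
  next
    case (Suc m)
    define J where "J = {2 * v, Suc (2 * v)}"
    have JI: "J \<inter> I = {}" using Compute.prems(8)[of v] by (simp add: J_def)
    have I': "finite (I \<union> J)" using Compute.prems(1) by (simp add: J_def)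
    have "finite J" by (simp add: J_def)
    have v: "v \<notin> operands p" and opS: "operands p \<subseteq> S"
      using Compute.prems(5,7) by auto
    then have "(\<lambda>i. 2 * i) ` operands p \<subseteq> I \<union> J" using Compute.prems(4) by blast
    from operation_encoding[OF I' _ _ this v] obtain q q' where q: "q \<in> polys (I \<union> J) 2" "q' \<in> polys (I \<union> J) 2"
      and enc1: "\<And>z. q z = 0 \<Longrightarrow> q' z = 0 \<Longrightarrow>
        registers z \<in> operation_dom p \<and> z (2 * v) = operation_val p (registers z)"
      and enc2: "\<And>z. registers z \<in> operation_dom p \<Longrightarrow>
         \<exists>u. q (z(2 * v := operation_val p (registers z), Suc (2 * v) := u)) = 0 \<and>
             q' (z(2 * v := operation_val p (registers z), Suc (2 * v) := u)) = 0"
      unfolding J_def by auto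
    define F' where "F' z = F z + ((q z)\<^sup>2 + (q' z)\<^sup>2)" for z
    define X where "X = {z \<in> zero_set I F. accepts k (Compute v p t) (registers z)}"
    define X' where "X' = {z \<in> zero_set (I \<union> J) F'. accepts m t (registers z)}"
    have img: "forget J ` X' \<subseteq> X"
    proof (rule image_subsetI)
      fix z assume z: "z \<in> X'"
      then have "z \<in> zero_set (I \<union> J) (\<lambda>z. F z + ((q z)\<^sup>2 + (q' z)\<^sup>2))"
        by (simp add: X'_def F'_def[abs_def])
      note zf = zero_set_forget[OF Compute.prems(2,3) JI this]
      have eq: "registers (forget J z) i = registers z i" if "i \<noteq> v" for i
        using that by (simp add: registers_def forget_def J_def)
      have "\<And>i. i \<in> operands p \<Longrightarrow> registers (forget J z) i = registers z i" using eq v by metis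
      note cong = operation_cong[OF this]
      \<comment> \<open>The projection erases register \<open>v\<close>, but the vertex recomputes
        it, and by the equations with the value that \<open>z\<close> had there.\<close>
      have "(registers (forget J z))(v := operation_val p (registers z)) = registers z"
        using eq enc1[OF zf(2,3)] by (auto simp: registers_apply)
      then show "forget J z \<in> X"
        using z zf(1) enc1[OF zf(2,3)] cong by (simp add: X_def X'_def Suc)
    qed
    have sub: "A \<subseteq> forget J ` X'"
    proof
      fix a assume "a \<in> A"
      then have a: "a \<in> zero_set I F" "registers a \<in> operation_dom p"
        "accepts m t ((registers a)(v := operation_val p (registers a)))"
        using Compute.prems(10) Suc by (auto simp: pairwise_disconnected_def)
      obtain u where u: "q (a(2 * v := operation_val p (registers a), Suc (2 * v) := u)) = 0"
          "q' (a(2 * v := operation_val p (registers a), Suc (2 * v) := u)) = 0"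
        using enc2[OF a(2)] by blast
      define z where "z = a(2 * v := operation_val p (registers a), Suc (2 * v) := u)"
      have "registers z = (registers a)(v := operation_val p (registers a))"
      proof
        fix i show "registers z i = ((registers a)(v := operation_val p (registers a))) i"
          unfolding registers_def z_def by simp
      qed
      moreover have "F z = F a"
        using JI by (intro polys_cong[OF Compute.prems(2)]) (auto simp: z_def J_def)
      moreover have "\<forall>i. i \<notin> I \<union> J \<longrightarrow> z i = 0" using a(1) by (auto simp: z_def J_def zero_set_def)
      ultimately have "z \<in> X'" using a u by (simp add: X'_def zero_set_def F'_def z_def)
      moreover have "forget J z = a"
        using a(1) JI by (auto simp: forget_def z_def J_def zero_set_def)
      ultimately show "a \<in> forget J ` X'" by blast
    qed
    obtain A' where A': "finite A'" "pairwise_disconnected X' A'" "card A' = card A"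
      using lift_pairwise_disconnected[OF continuous_forget img _ sub] Compute.prems(9,10) by (auto simp: X_def)
    have "card A' \<le> component_bound m t * 3 ^ card (I \<union> J)"
    proof (rule Compute.IH[OF I'])
      show "F' \<in> polys (I \<union> J) 4" unfolding F'_def[abs_def]
        by (rule sum_squares_polys[OF Compute.prems(1) \<open>finite J\<close> Compute.prems(2) q])
      show "0 \<le> F' z" for z using Compute.prems(3) by (simp add: F'_def)
      show "(\<lambda>i. 2 * i) ` insert v S \<subseteq> I \<union> J" using Compute.prems(4) by (auto simp: J_def)
      show "refs_ok (insert v S) t" using Compute.prems(5) by simp
      show "distinct (vertices t)" "set (vertices t) \<inter> insert v S = {}" using Compute.prems(6,7) by auto
      show "2 * w \<notin> I \<union> J \<and> Suc (2 * w) \<notin> I \<union> J" if "w \<in> set (vertices t)" for w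
        using Compute.prems(6) Compute.prems(8)[of w] that by (auto simp: J_def; presburger)
      show "finite A'" by fact
      show "pairwise_disconnected {z \<in> zero_set (I \<union> J) F'. accepts m t (registers z)} A'"
        using A'(2) by (simp add: X'_def)
    qed
    moreover have "card (I \<union> J) = card I + 2"
      using JI Compute.prems(1) \<open>finite J\<close> by (subst card_Un_disjoint) (auto simp: J_def)
    ultimately show ?thesis using A'(3) Suc by (simp add: power_add mult_ac)
  qed
next
  case (Test v i r t u)
  show ?case
  proof (cases k)
    case 0
    then have "A = {}" using Test.prems(10) by (auto simp: pairwise_disconnected_def)
    then show ?thesis by simp
  next
    case (Suc m)
    define J where "J = {Suc (2 * v)}"
    have JI: "J \<inter> I = {}" using Test.prems(8)[of v] by (simp add: J_def)
    have "finite J" by (simp add: J_def)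
    then have I': "finite (I \<union> J)" using Test.prems(1) by simp
    have iI: "2 * i \<in> I" using Test.prems(4,5) by auto
    have card_I': "card (I \<union> J) = Suc (card I)"
      using JI Test.prems(1) \<open>finite J\<close> by (subst card_Un_disjoint) (auto simp: J_def)
    have regJ: "registers (forget J z) = registers z" for z
    proof
      fix i
      have "2 * i \<noteq> Suc (2 * v)" by presburger
      then show "registers (forget J z) i = registers z i" by (simp add: registers_def forget_def J_def)
    qed
    \<comment> \<open>Both outcomes are treated at once; the induction hypothesis enters as an
      assumption because each child has its own.\<close>
    have branch: "card (A \<inter> {z. holds_zero r (z (2 * i)) \<longleftrightarrow> s}) \<le> 3 * (component_bound m t' * 3 ^ card I)"
      if t': "t' = (if s then t else u)"
        and IH: "\<And>F A. F \<in> polys (I \<union> J) 4 \<Longrightarrow> (\<And>z. 0 \<le> F z) \<Longrightarrow> finite A \<Longrightarrow>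
          pairwise_disconnected {z \<in> zero_set (I \<union> J) F. accepts m t' (registers z)} A \<Longrightarrow>
          card A \<le> component_bound m t' * 3 ^ card (I \<union> J)"
      for s t'
    proof -
      define A1 where "A1 = A \<inter> {z. holds_zero r (z (2 * i)) \<longleftrightarrow> s}"
      have A1: "finite A1" using Test.prems(9) by (simp add: A1_def)
      have "\<And>y. y \<in> (\<lambda>z. z (2 * i)) ` A1 \<Longrightarrow> holds_zero r y \<longleftrightarrow> s" by (auto simp: A1_def)
      then have "\<exists>a b c e. (\<forall>y u. a * y + b * (y * u) + c * u\<^sup>2 + e = 0 \<longrightarrow> (holds_zero r y \<longleftrightarrow> s)) \<and>
          (\<forall>y\<in>(\<lambda>z. z (2 * i)) ` A1. \<exists>u. a * y + b * (y * u) + c * u\<^sup>2 + e = 0)"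
        by (intro test_encoding finite_imageI A1)
      then obtain a b c e
        where enc: "\<forall>y u. a * y + b * (y * u) + c * u\<^sup>2 + e = 0 \<longrightarrow> (holds_zero r y \<longleftrightarrow> s)"
          "\<forall>y\<in>(\<lambda>z. z (2 * i)) ` A1. \<exists>u. a * y + b * (y * u) + c * u\<^sup>2 + e = 0"
        by (elim exE conjE)
      have enc1: "holds_zero r y \<longleftrightarrow> s" if "a * y + b * (y * u) + c * u\<^sup>2 + e = 0" for y u
        using enc(1) that by blast
      have enc2: "\<exists>u. a * y (2 * i) + b * (y (2 * i) * u) + c * u\<^sup>2 + e = 0" if "y \<in> A1" for y
        using enc(2) that by blast
      define q where "q z = a * z (2 * i) + b * (z (2 * i) * z (Suc (2 * v))) + c * (z (Suc (2 * v)))\<^sup>2 + e"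
        for z :: "nat \<Rightarrow> real"
      have q: "q \<in> polys (I \<union> J) 2"
        unfolding q_def[abs_def] power2_eq_square using iI
        by (intro polys_add polys_cmult polys_var_mult polys_const polys_var I') (auto simp: J_def)
      \<comment> \<open>The single equation is counted twice to fit the lemmas for two
        equations.\<close>
      define F' where "F' z = F z + ((q z)\<^sup>2 + (q z)\<^sup>2)" for z
      define X where "X = {z \<in> zero_set I F. accepts k (Test v i r t u) (registers z)}"
      define X' where "X' = {z \<in> zero_set (I \<union> J) F'. accepts m t' (registers z)}"
      have "pairwise_disconnected X A1"
        using Test.prems(10) by (auto simp: pairwise_disconnected_def X_def A1_def)
      moreover have "forget J ` X' \<subseteq> X"
      proof (rule image_subsetI)
        fix z assume z: "z \<in> X'"
        then have "z \<in> zero_set (I \<union> J) (\<lambda>z. F z + ((q z)\<^sup>2 + (q z)\<^sup>2))"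
          by (simp add: X'_def F'_def[abs_def])
        note zf = zero_set_forget[OF Test.prems(2,3) JI this]
        have "holds_zero r (z (2 * i)) \<longleftrightarrow> s" using enc1 zf(2) by (simp add: q_def)
        then have "holds_zero r (registers z i) \<longleftrightarrow> s" by (simp add: registers_apply)
        then show "forget J z \<in> X"
          using z zf(1) by (cases s) (simp_all add: X_def X'_def Suc regJ t')
      qed
      moreover have "A1 \<subseteq> forget J ` X'"
      proof
        fix y assume y: "y \<in> A1"
        then have yA: "y \<in> zero_set I F" "accepts k (Test v i r t u) (registers y)" "holds_zero r (y (2 * i)) \<longleftrightarrow> s"
          using Test.prems(10) by (auto simp: pairwise_disconnected_def A1_def)
        then have acc: "accepts m t' (registers y)" by (simp add: Suc t' registers_apply split: if_splits)
        obtain w where w: "a * y (2 * i) + b * (y (2 * i) * w) + c * w\<^sup>2 + e = 0" using enc2[OF y] by blast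
        define z where "z = y(Suc (2 * v) := w)"
        have zy: "forget J z = y"
          using yA(1) JI by (auto simp: forget_def z_def J_def zero_set_def)
        have "2 * i \<noteq> Suc (2 * v)" by presburger
        then have "z (2 * i) = y (2 * i)" by (simp add: z_def)
        then have "q z = 0" using w by (simp add: q_def z_def)
        moreover have "F z = F y"
          using JI by (intro polys_cong[OF Test.prems(2)]) (auto simp: z_def J_def)
        moreover have "\<forall>i. i \<notin> I \<union> J \<longrightarrow> z i = 0" using yA(1) by (auto simp: z_def J_def zero_set_def)
        moreover have "registers z = registers y" using regJ[of z] zy by simp
        ultimately have "z \<in> X'" using yA(1) acc by (simp add: X'_def zero_set_def F'_def)
        then show "y \<in> forget J ` X'" using zy by blast
      qed
      ultimately obtain A' where A': "finite A'" "pairwise_disconnected X' A'" "card A' = card A1"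
        using lift_pairwise_disconnected[OF continuous_forget] A1 by metis
      have "card A' \<le> component_bound m t' * 3 ^ card (I \<union> J)"
      proof (rule IH)
        show "F' \<in> polys (I \<union> J) 4" unfolding F'_def[abs_def]
          by (rule sum_squares_polys[OF Test.prems(1) \<open>finite J\<close> Test.prems(2) q q])
        show "0 \<le> F' z" for z using Test.prems(3) by (simp add: F'_def)
        show "finite A'" by fact
        show "pairwise_disconnected {z \<in> zero_set (I \<union> J) F'. accepts m t' (registers z)} A'"
          using A'(2) by (simp add: X'_def)
      qed
      then show ?thesis using A'(3) card_I' by (simp add: A1_def)
    qed
    have SJ: "(\<lambda>i. 2 * i) ` S \<subseteq> I \<union> J" using Test.prems(4) by blast
    have freshJ: "2 * w \<notin> I \<union> J \<and> Suc (2 * w) \<notin> I \<union> J" if "w \<in> set (vertices t @ vertices u)" for w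
      using Test.prems(6) Test.prems(8)[of w] that by (auto simp: J_def; presburger)
    have "card A = card (A \<inter> {z. holds_zero r (z (2 * i)) \<longleftrightarrow> True} \<union> A \<inter> {z. holds_zero r (z (2 * i)) \<longleftrightarrow> False})"
      by (rule arg_cong[of _ _ card]) blast
    also have "\<dots> \<le> card (A \<inter> {z. holds_zero r (z (2 * i)) \<longleftrightarrow> True}) + card (A \<inter> {z. holds_zero r (z (2 * i)) \<longleftrightarrow> False})"
      by (rule card_Un_le)
    also have "\<dots> \<le> 3 * (component_bound m t * 3 ^ card I) + 3 * (component_bound m u * 3 ^ card I)"
    proof (intro add_mono branch)
      show "card A \<le> component_bound m t * 3 ^ card (I \<union> J)"
        if "F \<in> polys (I \<union> J) 4" "\<And>z. 0 \<le> F z" "finite A"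
          "pairwise_disconnected {z \<in> zero_set (I \<union> J) F. accepts m t (registers z)} A" for F A
        using Test.prems(5,6,7) freshJ by (intro Test.IH(1)[OF I' that(1,2) SJ _ _ _ _ that(3,4)]) auto
      show "card A \<le> component_bound m u * 3 ^ card (I \<union> J)"
        if "F \<in> polys (I \<union> J) 4" "\<And>z. 0 \<le> F z" "finite A"
          "pairwise_disconnected {z \<in> zero_set (I \<union> J) F. accepts m u (registers z)} A" for F A
        using Test.prems(5,6,7) freshJ by (intro Test.IH(2)[OF I' that(1,2) SJ _ _ _ _ that(3,4)]) auto
    qed simp_all
    finally show ?thesis by (simp add: Suc algebra_simps)
  qed
qed

text \<open>The induction starts from the zero polynomial on the even coordinates of the inputs;
  \<open>registers\<close> carries this space continuously onto the inputs.\<close>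

corollary accepting_set_components_bound:
  assumes T: "refs_ok {..<n} T" "distinct (vertices T)" "set (vertices T) \<inter> {..<n} = {}"
    and A: "finite A" "pairwise_disconnected {x \<in> topspace (Euclidean_space n). accepts k T x} A"
  shows "card A \<le> component_bound k T * 3 ^ n"
proof -
  define I where "I = (\<lambda>i. 2 * i) ` {..<n}"
  define X where "X = {z \<in> zero_set I (\<lambda>z. 0). accepts k T (registers z)}"
  have "continuous_on X registers"
    unfolding registers_def[abs_def]
    by (intro continuous_on_coordinatewise_then_product
        continuous_on_subset[OF continuous_on_product_coordinates subset_UNIV])
  moreover have "registers ` X \<subseteq> {x \<in> topspace (Euclidean_space n). accepts k T x}"
  proof (rule image_subsetI)
    fix z assume z: "z \<in> X"
    have "2 * i \<notin> I" if "n \<le> i" for i using that by (auto simp: I_def)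
    then have "registers z i = 0" if "n \<le> i" for i
      using z that by (simp add: X_def zero_set_def registers_apply)
    then show "registers z \<in> {x \<in> topspace (Euclidean_space n). accepts k T x}"
      using z by (simp add: X_def topspace_Euclidean_space)
  qed
  moreover have "A \<subseteq> registers ` X"
  proof
    fix a assume a: "a \<in> A"
    define z where "z j = (if even j then a (j div 2) else 0)" for j
    have ra: "registers z = a" by (simp add: registers_def z_def)
    have a': "\<forall>i\<ge>n. a i = 0" "accepts k T a"
      using a A(2) by (auto simp: pairwise_disconnected_def topspace_Euclidean_space)
    have "z j = 0" if "j \<notin> I" for j
    proof (cases "even j \<and> j div 2 < n")
      case True
      then have "j \<in> I" unfolding I_def by (intro image_eqI[of _ _ "j div 2"]) auto
      then show ?thesis using that by simp
    qed (use a'(1) in \<open>auto simp: z_def\<close>)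
    then have "z \<in> X" using a'(2) ra by (simp add: X_def zero_set_def)
    then show "a \<in> registers ` X" using ra by blast
  qed
  ultimately obtain A' where A': "finite A'" "pairwise_disconnected X A'" "card A' = card A"
    using lift_pairwise_disconnected[OF _ _ A(2) _ A(1)] by metis
  have "card A' \<le> component_bound k T * 3 ^ card I"
  proof (rule accepts_components_bound[OF _ polys_0 _ _ T(1,2,3) _ A'(1)])
    show "(\<lambda>i. 2 * i) ` {..<n} \<subseteq> I" by (simp add: I_def)
    show "2 * v \<notin> I \<and> Suc (2 * v) \<notin> I" if "v \<in> set (vertices T)" for v
      using that T(3) unfolding I_def by (auto simp: disjoint_iff)
  qed (use A'(2) in \<open>auto simp: X_def I_def\<close>)
  moreover have "card I = n" unfolding I_def by (subst card_image) (auto intro: inj_onI)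
  ultimately show ?thesis using A'(3) by simp
qed

section \<open>The translation of a tree and its entropy\<close>

text \<open>A form of "\<open>G\<close> is the translation of \<open>t\<close>" that passes to
  subtrees: \<open>G\<close> may have further edges, but none leaving a vertex of \<open>t\<close>.
  Inductions on the tree can thus keep \<open>G\<close> fixed.\<close>

definition embedded :: "act \<Rightarrow> graph \<Rightarrow> bool" where
  "embedded t G \<longleftrightarrow> distinct (vertices t) \<and> act_edges t \<subseteq> edges G \<and>
    (\<forall>e\<in>edges G. \<forall>x v. v \<in> set (vertices t) \<and> (x, Vertex v) \<in> source e \<longrightarrow> e \<in> act_edges t)"

lemma act_edges_source: "e \<in> act_edges t \<Longrightarrow> c \<in> source e \<Longrightarrow> snd c \<in> Vertex ` set (vertices t)"
proof (induction t)
  case (Compute v p t)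
  then show ?case by (cases "e \<in> act_edges t") auto
next
  case (Test v i r t u)
  then show ?case by (cases "e \<in> act_edges t"; cases "e \<in> act_edges u") auto
qed simp

lemma root_state_cases: "root_state t \<in> Vertex ` set (vertices t) \<union> {Top, Bot}"
  by (cases t) auto

lemma act_edges_source_Vertex: "e \<in> act_edges t \<Longrightarrow> (x, Vertex v) \<in> source e \<Longrightarrow> v \<in> set (vertices t)"
  using act_edges_source[of e t "(x, Vertex v)"] by auto

lemma embeddedD:
  "embedded t G \<Longrightarrow> e \<in> edges G \<Longrightarrow> (x, Vertex v) \<in> source e \<Longrightarrow> v \<in> set (vertices t) \<Longrightarrow> e \<in> act_edges t"
  unfolding embedded_def by blast

lemma embedded_Compute: assumes "embedded (Compute v p t) G" shows "embedded t G"
proof -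
  have "e \<in> act_edges t" if "e \<in> edges G" "(x, Vertex w) \<in> source e" "w \<in> set (vertices t)" for e x w
    using embeddedD[OF assms that(1,2)] that assms by (auto simp: embedded_def)
  then show ?thesis using assms by (auto simp: embedded_def)
qed

lemma embedded_Test:
  assumes "embedded (Test v i r t u) G" shows "embedded t G" "embedded u G"
proof -
  have d: "distinct (v # vertices t @ vertices u)" using assms by (simp add: embedded_def)
  have e: "e \<in> act_edges t \<or> e \<in> act_edges u"
    if "e \<in> edges G" "(x, Vertex w) \<in> source e" "w \<in> set (vertices t @ vertices u)" for e x w
  proof -
    have "e \<in> act_edges (Test v i r t u)" using embeddedD[OF assms that(1,2)] that(3) by auto
    then show ?thesis using that d by auto
  qed
  have "e \<in> act_edges t" if "e \<in> edges G" "(x, Vertex w) \<in> source e" "w \<in> set (vertices t)" for e x w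
    using e[OF that(1,2)] that act_edges_source_Vertex[of e u x w] d by auto
  then show "embedded t G" using assms unfolding embedded_def by auto
  have "e \<in> act_edges u" if "e \<in> edges G" "(x, Vertex w) \<in> source e" "w \<in> set (vertices u)" for e x w
    using e[OF that(1,2)] that act_edges_source_Vertex[of e t x w] d by auto
  then show "embedded u G" using assms unfolding embedded_def by auto
qed

lemma graph_map_edge:
  assumes "e \<in> edges G" "(x, Vertex v) \<in> source e" "\<And>e'. e' \<in> edges G \<Longrightarrow> (x, Vertex v) \<in> source e' \<Longrightarrow> e' = e"
  shows "graph_map G (x, Vertex v) = Some (realiser e x, target e)"
proof -
  have "(THE e. e \<in> edges G \<and> (x, Vertex v) \<in> source e) = e"
    by (rule the_equality) (use assms in blast)+
  moreover have "\<exists>e\<in>edges G. (x, Vertex v) \<in> source e" using assms(1,2) by blast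
  ultimately show ?thesis by (simp add: graph_map_def)
qed

lemma graph_map_Compute:
  assumes "embedded (Compute v p t) G"
  shows "graph_map G (x, Vertex v) =
    (if x \<in> operation_dom p then Some (x(v := operation_val p x), root_state t) else None)"
proof -
  let ?e = "\<lparr>source = operation_dom p \<times> {Vertex v}, realiser = (\<lambda>x. x(v := operation_val p x)), target = root_state t\<rparr>"
  have uniq: "e' = ?e" if "e' \<in> edges G" "(x, Vertex v) \<in> source e'" for e'
  proof -
    have "e' \<in> act_edges (Compute v p t)" "v \<notin> set (vertices t)"
      using embeddedD[OF assms that] assms by (auto simp: embedded_def)
    then show ?thesis using act_edges_source_Vertex[of e' t x v] that(2) by auto
  qed
  have "?e \<in> edges G" using assms by (auto simp: embedded_def)
  show ?thesis
  proof (cases "x \<in> operation_dom p")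
    case True
    then show ?thesis using graph_map_edge[OF \<open>?e \<in> edges G\<close> _ uniq] by simp
  next
    case False
    then have "\<not> (\<exists>e\<in>edges G. (x, Vertex v) \<in> source e)" using uniq by fastforce
    then show ?thesis using False by (simp add: graph_map_def)
  qed
qed

lemma graph_map_Test:
  assumes "embedded (Test v i r t u) G"
  shows "graph_map G (x, Vertex v) = Some (x, if holds_zero r (x i) then root_state t else root_state u)"
proof -
  let ?e = "\<lparr>source = {x. holds_zero r (x i)} \<times> {Vertex v}, realiser = id, target = root_state t\<rparr>"
  let ?e' = "\<lparr>source = (- {x. holds_zero r (x i)}) \<times> {Vertex v}, realiser = id, target = root_state u\<rparr>"
  have uniq: "e' = ?e \<or> e' = ?e'" if "e' \<in> edges G" "(x, Vertex v) \<in> source e'" for e'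
  proof -
    have "e' \<in> act_edges (Test v i r t u)" using embeddedD[OF assms that] by simp
    moreover have "v \<notin> set (vertices t)" "v \<notin> set (vertices u)" using assms by (auto simp: embedded_def)
    ultimately show ?thesis
      using act_edges_source_Vertex[of e' t x v] act_edges_source_Vertex[of e' u x v] that(2) by auto
  qed
  have mem: "?e \<in> edges G" "?e' \<in> edges G" using assms by (auto simp: embedded_def)
  show ?thesis
  proof (cases "holds_zero r (x i)")
    case True
    then have "e' = ?e" if "e' \<in> edges G" "(x, Vertex v) \<in> source e'" for e' using uniq[OF that] that by auto
    then show ?thesis using graph_map_edge[OF mem(1)] True by simp
  next
    case False
    then have "e' = ?e'" if "e' \<in> edges G" "(x, Vertex v) \<in> source e'" for e' using uniq[OF that] that by auto
    then show ?thesis using graph_map_edge[OF mem(2)] False by simp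
  qed
qed

lemma piterate_absorbing:
  assumes "s \<in> {Top, Bot}" shows "piterate (graph_map G) k (x, s) = Some (x, s)"
  using assms by (induction k) (auto simp: map_comp_def graph_map_def)

lemma piterate_Suc_apply:
  "piterate f (Suc k) c = (case f c of None \<Rightarrow> None | Some d \<Rightarrow> piterate f k d)"
  by (simp add: map_comp_def)

lemma accepts_iff:
  "embedded t G \<Longrightarrow> (\<exists>y. piterate (graph_map G) k (x, root_state t) = Some (y, Top)) \<longleftrightarrow> accepts k t x"
proof (induction t arbitrary: k x)
  case (Leaf b)
  then show ?case by (simp add: piterate_absorbing)
next
  case (Compute v p t)
  show ?case
  proof (cases k)
    case (Suc m)
    then show ?thesis using Compute.IH[OF embedded_Compute[OF Compute.prems]]
      by (simp add: piterate_Suc_apply graph_map_Compute[OF Compute.prems] fun_upd_def del: piterate.simps)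
  qed simp
next
  case (Test v i r t u)
  show ?case
  proof (cases k)
    case (Suc m)
    then show ?thesis using Test.IH(1)[OF embedded_Test(1)[OF Test.prems]] Test.IH(2)[OF embedded_Test(2)[OF Test.prems]]
      by (simp add: piterate_Suc_apply graph_map_Test[OF Test.prems] del: piterate.simps)
  qed simp
qed

text \<open>Every edge leads strictly down the tree. The start \<open>s\<close> is any state, not
  only the root, because the entropy takes all configurations into account.\<close>

lemma piterate_terminates:
  "embedded t G \<Longrightarrow> length (vertices t) \<le> k \<Longrightarrow> s \<in> Vertex ` set (vertices t) \<union> {Top, Bot} \<Longrightarrow>
    piterate (graph_map G) k (x, s) = Some d \<Longrightarrow> snd d \<in> {Top, Bot}"
proof (induction t arbitrary: k x s)
  case (Leaf b)
  then show ?case by (auto simp: piterate_absorbing)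
next
  case (Compute v p t)
  note IH = Compute.IH[OF embedded_Compute[OF Compute.prems(1)]]
  show ?case
  proof (cases "s = Vertex v")
    case True
    obtain m where "k = Suc m" using Compute.prems(2) by (cases k) auto
    then show ?thesis using Compute.prems(2,4) IH[OF _ root_state_cases] True
      by (auto simp: piterate_Suc_apply graph_map_Compute[OF Compute.prems(1)] simp del: piterate.simps split: if_splits)
  next
    case False
    then show ?thesis using Compute.prems(2-4) IH[of k s x] by auto
  qed
next
  case (Test v i r t u)
  note IH = Test.IH(1)[OF embedded_Test(1)[OF Test.prems(1)]] Test.IH(2)[OF embedded_Test(2)[OF Test.prems(1)]]
  show ?case
  proof (cases "s = Vertex v")
    case True
    obtain m where "k = Suc m" using Test.prems(2) by (cases k) auto
    then show ?thesis using Test.prems(2,4) IH(1)[OF _ root_state_cases, of m x] IH(2)[OF _ root_state_cases, of m x] True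
      by (cases "holds_zero r (x i)")
        (simp_all add: piterate_Suc_apply graph_map_Test[OF Test.prems(1)] del: piterate.simps)
  next
    case False
    then show ?thesis using Test.prems(2-4) IH(1)[of k s x] IH(2)[of k s x] by auto
  qed
qed

lemma embedded_translation: "act_on n T \<Longrightarrow> embedded T (translation T)"
  by (auto simp: embedded_def act_on_def translation_def)

lemma piterate_add: "piterate f (i + j) c = (case piterate f i c of None \<Rightarrow> None | Some d \<Rightarrow> piterate f j d)"
proof (induction i arbitrary: c)
  case (Suc i)
  then show ?case by (cases "f c") (simp_all add: piterate_Suc_apply del: piterate.simps)
qed simp

lemma graph_map_target:
  "embedded t G \<Longrightarrow> v \<in> set (vertices t) \<Longrightarrow> graph_map G (x, Vertex v) = Some d \<Longrightarrow>
    snd d \<in> Vertex ` set (vertices t) \<union> {Top, Bot}"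
proof (induction t)
  case (Compute w p t)
  show ?case
  proof (cases "v = w")
    case True
    then show ?thesis using Compute.prems root_state_cases[of t]
      by (auto simp: graph_map_Compute[OF Compute.prems(1)] split: if_splits)
  next
    case False
    then show ?thesis using Compute.IH[OF embedded_Compute[OF Compute.prems(1)]] Compute.prems(2,3) by auto
  qed
next
  case (Test w i r t u)
  show ?case
  proof (cases "v = w")
    case True
    then show ?thesis using Test.prems(3) root_state_cases[of t] root_state_cases[of u]
      by (cases "holds_zero r (x i)") (auto simp: graph_map_Test[OF Test.prems(1)])
  next
    case False
    then show ?thesis using Test.IH(1)[OF embedded_Test(1)[OF Test.prems(1)]]
        Test.IH(2)[OF embedded_Test(2)[OF Test.prems(1)]] Test.prems(2,3) by auto
  qed
qed simp

text \<open>The type \<open>config\<close> has states foreign to the graph; this keeps every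
  intermediate point of a surviving orbit inside the region that \<open>state_cover\<close>
  covers.\<close>

lemma graph_map_translation_in_config_space:
  assumes T: "embedded T (translation T)" and c: "graph_map (translation T) c = Some d"
  shows "c \<in> config_space (translation T) \<and> d \<in> config_space (translation T)"
proof (cases "snd c")
  case (Vertex v)
  then obtain x where cx: "c = (x, Vertex v)" by (cases c) auto
  then obtain e where "e \<in> act_edges T" "c \<in> source e"
    using c by (auto simp: graph_map_def translation_def split: if_splits)
  then have v: "v \<in> set (vertices T)" using act_edges_source_Vertex cx by blast
  then have "snd d \<in> Vertex ` set (vertices T) \<union> {Top, Bot}" using graph_map_target[OF T v] c cx by simp
  then show ?thesis using v cx by (cases d) (auto simp: config_space_def translation_def)
next
  case Top
  then have "d = c" using c by (simp add: graph_map_def)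
  then show ?thesis using Top by (cases c) (simp add: config_space_def translation_def)
next
  case Bot
  then have "d = c" using c by (simp add: graph_map_def)
  then show ?thesis using Bot by (cases c) (simp add: config_space_def translation_def)
qed

lemma preimage_piterate_absorbing:
  assumes "s \<in> {Top, Bot}" "c \<in> preimage (piterate (graph_map G) i) (UNIV \<times> {s})"
  shows "c \<in> preimage (piterate (graph_map G) (i + j)) (UNIV \<times> {s})"
  using assms piterate_absorbing[OF assms(1)] by (auto simp: preimage_def piterate_add)

section \<open>Iterated joins, cover numbers and the entropy\<close>

lemma finite_iterated_join: "finite \<U> \<Longrightarrow> finite (iterated_join f \<U> m)"
proof (induction m)
  case (Suc m)
  have "join (iterated_join f \<U> m) (preimage (piterate f (Suc m)) ` \<U>)
      = (\<lambda>(U, V). U \<inter> V) ` (iterated_join f \<U> m \<times> preimage (piterate f (Suc m)) ` \<U>)"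
    by (auto simp: join_def)
  then show ?case using Suc by simp
qed simp

lemma iterated_join_last:
  assumes "V \<in> iterated_join f \<U> m" shows "\<exists>U\<in>\<U>. V \<subseteq> preimage (piterate f m) U"
proof (cases m)
  case 0
  then show ?thesis using assms by (intro bexI[of _ V]) (auto simp: preimage_def)
next
  case (Suc k)
  then show ?thesis using assms by (auto simp: join_def simp del: piterate.simps)
qed

lemma iterated_join_covers:
  assumes "\<And>i. i \<le> m \<Longrightarrow> \<exists>d\<in>\<Union>\<U>. piterate f i c = Some d"
  shows "\<exists>V\<in>iterated_join f \<U> m. c \<in> V"
  using assms
proof (induction m)
  case 0
  then show ?case by auto
next
  case (Suc m)
  then obtain V where V: "V \<in> iterated_join f \<U> m" "c \<in> V" by fastforce
  obtain d U where "U \<in> \<U>" "d \<in> U" "piterate f (Suc m) c = Some d" using Suc.prems[of "Suc m"] by blast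
  then have U: "U \<in> \<U>" "c \<in> preimage (piterate f (Suc m)) U" by (auto simp: preimage_def)
  have "V \<inter> preimage (piterate f (Suc m)) U \<in> iterated_join f \<U> (Suc m)"
    unfolding iterated_join.simps join_def using V(1) U(1) by blast
  then show ?case using V(2) U(2) by blast
qed

lemma cover_number_bounds:
  assumes "finite \<D>" "\<D> \<subseteq> \<V>" "Y \<subseteq> \<Union>\<D>" "Y \<noteq> {}"
  shows "1 \<le> cover_number Y \<V>" "cover_number Y \<V> \<le> card \<D>"
proof -
  let ?P = "\<lambda>m. \<exists>\<C>\<subseteq>\<V>. finite \<C> \<and> card \<C> = m \<and> Y \<subseteq> \<Union>\<C>"
  have P: "?P (card \<D>)" using assms by blast
  then show "cover_number Y \<V> \<le> card \<D>" unfolding cover_number_def by (rule Least_le)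
  have "?P (cover_number Y \<V>)" unfolding cover_number_def by (rule LeastI[of ?P, OF P])
  then obtain \<C> where "finite \<C>" "card \<C> = cover_number Y \<V>" "Y \<subseteq> \<Union>\<C>" by blast
  moreover from this assms(4) have "card \<C> \<noteq> 0" by (auto simp: card_eq_0_iff)
  ultimately show "1 \<le> cover_number Y \<V>" by linarith
qed

text \<open>
  After \<open>length (vertices T)\<close> steps every orbit has been absorbed, so the joins no longer need
  new sets to cover the domain, and the entropy vanishes.
\<close>

theorem state_cover_entropy_translation:
  assumes "act_on n T" shows "state_cover_entropy (translation T) = 0"
proof -
  define G where "G = translation T"
  define f where "f = graph_map G"
  define X where "X = config_space G"
  define \<U> where "\<U> = state_cover G"
  define l where "l = length (vertices T)"
  have T: "embedded T G" unfolding G_def by (rule embedded_translation[OF assms])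
  have states: "states G = Vertex ` set (vertices T) \<union> {Top, Bot}" by (simp add: G_def translation_def)
  have "\<U> = (\<lambda>s. UNIV \<times> {s}) ` states G" by (auto simp: \<U>_def state_cover_def)
  then have fin: "finite (iterated_join f \<U> l)" by (intro finite_iterated_join) (simp add: states)
  have UX: "\<Union>\<U> = X" by (auto simp: \<U>_def state_cover_def X_def config_space_def)
  \<comment> \<open>Each of these sets lies in every later preimage of its absorbing state, so
    intersecting with that preimage changes nothing and the set recurs in all later joins.\<close>
  define \<D> where "\<D> = {V \<in> iterated_join f \<U> l. \<exists>s\<in>{Top, Bot}. V \<subseteq> preimage (piterate f l) (UNIV \<times> {s})}"
  have sub: "\<D> \<subseteq> iterated_join f \<U> (l + j)" for j
  proof (induction j)
    case 0
    then show ?case by (auto simp: \<D>_def)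
  next
    case (Suc j)
    show ?case
    proof
      fix V assume V: "V \<in> \<D>"
      then obtain s where s: "s \<in> {Top, Bot}" "V \<subseteq> preimage (piterate f l) (UNIV \<times> {s})" by (auto simp: \<D>_def)
      have "V \<subseteq> preimage (piterate f (l + Suc j)) (UNIV \<times> {s})"
        using s preimage_piterate_absorbing[OF s(1), of _ G l "Suc j"] unfolding f_def by blast
      then have "V = V \<inter> preimage (piterate f (Suc (l + j))) (UNIV \<times> {s})" by auto
      moreover have "UNIV \<times> {s} \<in> \<U>" using s(1) by (auto simp: \<U>_def state_cover_def states)
      moreover have "V \<in> iterated_join f \<U> (l + j)" using V Suc by blast
      ultimately have "V \<in> iterated_join f \<U> (Suc (l + j))"
        unfolding iterated_join.simps join_def by blast
      then show "V \<in> iterated_join f \<U> (l + Suc j)" by simp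
    qed
  qed
  have cover: "preimage (piterate f (l + j)) X \<subseteq> \<Union>\<D>" for j
  proof
    fix c assume c: "c \<in> preimage (piterate f (l + j)) X"
    have orbit: "\<exists>d\<in>X. piterate f i c = Some d" if i: "i \<le> l + j" for i
    proof (cases "i = l + j")
      case True
      then show ?thesis using c by (auto simp: preimage_def)
    next
      case False
      then obtain m where m: "l + j = i + Suc m" using i less_imp_Suc_add[of i "l + j"] by auto
      obtain e where "piterate f (i + Suc m) c = Some e" using c unfolding m by (auto simp: preimage_def)
      then obtain d where d: "piterate f i c = Some d" "piterate f (Suc m) d = Some e"
        using piterate_add[of f i "Suc m" c] by (cases "piterate f i c") (auto simp del: piterate.simps add_Suc_right)
      then obtain d' where "f d = Some d'"
        by (auto simp: piterate_Suc_apply simp del: piterate.simps split: option.splits)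
      then have "d \<in> X" using graph_map_translation_in_config_space T unfolding f_def G_def X_def by blast
      then show ?thesis using d(1) by blast
    qed
    then obtain V where V: "V \<in> iterated_join f \<U> l" "c \<in> V"
      using iterated_join_covers[of l \<U> f c] unfolding UX by (metis le_add1 order_trans)
    then obtain s where s: "V \<subseteq> preimage (piterate f l) (UNIV \<times> {s})"
      using iterated_join_last[OF V(1)] by (auto simp: \<U>_def state_cover_def)
    then obtain y where y: "piterate f l c = Some (y, s)" using V(2) by (auto simp: preimage_def)
    have "c \<in> X" using orbit[of 0] by simp
    then obtain x s0 where "c = (x, s0)" "s0 \<in> Vertex ` set (vertices T) \<union> {Top, Bot}"
      by (cases c) (auto simp: X_def config_space_def states)
    then have "s \<in> {Top, Bot}"
      using piterate_terminates[OF T, of l s0 x "(y, s)"] y by (auto simp: l_def f_def)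
    then have "V \<in> \<D>" using V(1) s by (auto simp: \<D>_def)
    then show "c \<in> \<Union>\<D>" using V(2) by blast
  qed
  \<comment> \<open>An empty domain would have cover number 0; with a cover number of at least 1 the
    logarithm is nonnegative.\<close>
  have nonempty: "preimage (piterate f k) X \<noteq> {}" for k
  proof -
    have "piterate f k (\<lambda>_. 0, Top) = Some (\<lambda>_. 0, Top)" unfolding f_def by (rule piterate_absorbing) simp
    moreover have "(\<lambda>_. 0, Top) \<in> X" by (simp add: X_def config_space_def states)
    ultimately have "(\<lambda>_. 0, Top) \<in> preimage (piterate f k) X" by (auto simp: preimage_def)
    then show ?thesis by blast
  qed
  define b where "b = log 2 (real (card \<D>))"
  have bounds: "0 \<le> Hk X f \<U> k \<and> Hk X f \<U> k \<le> b * inverse (real k)" if "l + 1 \<le> k" for k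
  proof -
    obtain j where j: "k - 1 = l + j" using \<open>l + 1 \<le> k\<close> le_Suc_ex[of l "k - 1"] by fastforce
    have "finite \<D>" using fin by (simp add: \<D>_def)
    note cn = cover_number_bounds[OF this sub[of j] cover[of j] nonempty]
    have "0 \<le> H0 (preimage (piterate f (k - 1)) X) (iterated_join f \<U> (k - 1))"
      "H0 (preimage (piterate f (k - 1)) X) (iterated_join f \<U> (k - 1)) \<le> b"
      unfolding H0_def j b_def using cn by (simp_all add: Suc_le_eq)
    then show ?thesis
      unfolding Hk_def using mult_left_mono[of _ b "inverse (real k)"] by (simp add: inverse_eq_divide mult.commute)
  qed
  have "(\<lambda>k. Hk X f \<U> k) \<longlonglongrightarrow> 0"
  proof (rule tendsto_sandwich)
    show "\<forall>\<^sub>F k in sequentially. 0 \<le> Hk X f \<U> k" "\<forall>\<^sub>F k in sequentially. Hk X f \<U> k \<le> b * inverse (real k)"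
      using bounds eventually_sequentially by blast+
    show "(\<lambda>k. b * inverse (real k)) \<longlonglongrightarrow> 0"
      using tendsto_mult[OF tendsto_const lim_inverse_n, of b] by simp
  qed simp
  then show ?thesis
    unfolding state_cover_entropy_def G_def[symmetric] f_def[symmetric] X_def[symmetric] \<U>_def[symmetric]
    by (rule limI)
qed

section \<open>Counting edges and components\<close>

fun tests :: "act \<Rightarrow> nat" where
  "tests (Leaf b) = 0"
| "tests (Compute v p t) = tests t"
| "tests (Test v i r t u) = Suc (tests t + tests u)"

fun computations :: "act \<Rightarrow> nat" where
  "computations (Leaf b) = 0"
| "computations (Compute v p t) = Suc (computations t)"
| "computations (Test v i r t u) = computations t + computations u"

lemma operation_dom_nonempty: "(\<lambda>_. 1) \<in> operation_dom p"
  by (cases p) auto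

lemma holds_zero_nonempty: "\<exists>a. holds_zero r a" "\<exists>a. \<not> holds_zero r a"
proof -
  have "holds_zero r (if r = Greater then 1 else 0)" by (cases r) auto
  then show "\<exists>a. holds_zero r a" ..
  have "\<not> holds_zero r (if r = Equal then 1 else if r = Greater then 0 else -1)" by (cases r) auto
  then show "\<exists>a. \<not> holds_zero r a" ..
qed

lemma act_edges_source_nonempty: "e \<in> act_edges t \<Longrightarrow> source e \<noteq> {}"
proof (induction t)
  case (Compute v p t)
  then show ?case using operation_dom_nonempty[of p] by auto
next
  case (Test v i r t u)
  obtain a b where ab: "holds_zero r a" "\<not> holds_zero r b" using holds_zero_nonempty by blast
  show ?case
  proof (cases "e \<in> act_edges t \<union> act_edges u")
    case True
    then show ?thesis using Test.IH by auto
  next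
    case False
    then have "(\<lambda>_. a, Vertex v) \<in> source e \<or> (\<lambda>_. b, Vertex v) \<in> source e"
      using Test.prems ab by auto
    then show ?thesis by auto
  qed
qed simp

text \<open>Edges form a set of records, so coinciding edges would merge. They are told apart by
  their sources, which are nonempty and sit at different vertices or, at a test, are
  complementary.\<close>

lemma card_act_edges:
  "distinct (vertices t) \<Longrightarrow> finite (act_edges t) \<and> card (act_edges t) = computations t + 2 * tests t"
proof (induction t)
  case (Compute v p t)
  let ?e = "\<lparr>source = operation_dom p \<times> {Vertex v}, realiser = (\<lambda>x. x(v := operation_val p x)), target = root_state t\<rparr>"
  have "?e \<notin> act_edges t"
    using act_edges_source_Vertex[of ?e t "\<lambda>_. 1" v] operation_dom_nonempty[of p] Compute.prems by auto
  then show ?case using Compute by simp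
next
  case (Test v i r t u)
  let ?e = "\<lparr>source = {x. holds_zero r (x i)} \<times> {Vertex v}, realiser = id, target = root_state t\<rparr>"
  let ?e' = "\<lparr>source = (- {x. holds_zero r (x i)}) \<times> {Vertex v}, realiser = id, target = root_state u\<rparr>"
  obtain a b where ab: "holds_zero r a" "\<not> holds_zero r b" using holds_zero_nonempty by blast
  have mem: "(\<lambda>_. a, Vertex v) \<in> source ?e" "(\<lambda>_. b, Vertex v) \<in> source ?e'" "(\<lambda>_. b, Vertex v) \<notin> source ?e"
    using ab by simp_all
  have "?e \<noteq> ?e'" using mem(2,3) by metis
  moreover have "?e \<notin> act_edges t \<union> act_edges u" "?e' \<notin> act_edges t \<union> act_edges u"
    using act_edges_source_Vertex[OF _ mem(1)] act_edges_source_Vertex[OF _ mem(2)] Test.prems by auto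
  moreover have "act_edges t \<inter> act_edges u = {}"
  proof (rule ccontr)
    assume "act_edges t \<inter> act_edges u \<noteq> {}"
    then obtain e where e: "e \<in> act_edges t" "e \<in> act_edges u" by blast
    then obtain c where "c \<in> source e" using act_edges_source_nonempty by blast
    then have "snd c \<in> Vertex ` set (vertices t)" "snd c \<in> Vertex ` set (vertices u)"
      using e act_edges_source by blast+
    then show False using Test.prems by auto
  qed
  ultimately show ?case using Test by (simp add: card_Un_disjoint)
qed simp

text \<open>There are \<open>tests t + 1\<close> leaves, and each vertex on the way costs at most
  9.\<close>

lemma component_bound_le: "component_bound k t \<le> (tests t + 1) * 9 ^ k"
proof (induction t arbitrary: k)
  case (Leaf b)
  then show ?case by simp
next
  case (Compute v p t)
  show ?case
  proof (cases k)
    case (Suc m)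
    then show ?thesis using Compute.IH[of m] by simp
  qed simp
next
  case (Test v i r t u)
  show ?case
  proof (cases k)
    case (Suc m)
    have "component_bound k (Test v i r t u) \<le> 3 * ((tests t + 1) * 9 ^ m + (tests u + 1) * 9 ^ m)"
      using Test.IH(1)[of m] Test.IH(2)[of m] by (simp add: Suc)
    also have "\<dots> = 3 * ((tests t + tests u + 2) * 9 ^ m)" by (simp add: algebra_simps)
    also have "\<dots> \<le> 9 * ((tests t + tests u + 2) * 9 ^ m)" by simp
    finally show ?thesis by (simp add: Suc algebra_simps)
  qed simp
qed

text \<open>All paths run through the topmost test, which costs 3 instead of 9; this gains the
  factor 3 hidden in the exponent \<open>2 * k + n - 1\<close>.\<close>

lemma component_bound_le_tests: "0 < tests t \<Longrightarrow> 3 * component_bound k t \<le> (tests t + 1) * 9 ^ k"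
proof (induction t arbitrary: k)
  case (Compute v p t)
  show ?case
  proof (cases k)
    case (Suc m)
    then show ?thesis using Compute.IH[of m] Compute.prems by simp
  qed simp
next
  case (Test v i r t u)
  show ?case
  proof (cases k)
    case (Suc m)
    have "component_bound k (Test v i r t u) \<le> 3 * ((tests t + 1) * 9 ^ m + (tests u + 1) * 9 ^ m)"
      using component_bound_le[of m t] component_bound_le[of m u] by (simp add: Suc)
    also have "\<dots> = 3 * ((tests t + tests u + 2) * 9 ^ m)" by (simp add: algebra_simps)
    finally show ?thesis by (simp add: Suc algebra_simps)
  qed simp
qed simp

text \<open>The two truth values let one form serve divisions, whose domain is the failure of
  \<open>Equal\<close>, square roots, and total operations, where both are
  \<open>True\<close>.\<close>

lemma operation_dom_as_test:
  "\<exists>i r b b'. i \<in> operands p \<and> (\<forall>x. x \<in> operation_dom p \<longleftrightarrow> (if holds_zero r (x i) then b else b'))"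
proof (cases p)
  case (Binary i a j)
  show ?thesis
  proof (cases "a = Div")
    case True
    then show ?thesis using Binary
      by (intro exI[of _ j] exI[of _ Equal] exI[of _ False] exI[of _ True]) simp
  next
    case False
    then show ?thesis using Binary
      by (intro exI[of _ j] exI[of _ Equal] exI[of _ True] exI[of _ True]) simp
  qed
next
  case (Scalar c a j)
  show ?thesis
  proof (cases "a = Div")
    case True
    then show ?thesis using Scalar
      by (intro exI[of _ j] exI[of _ Equal] exI[of _ False] exI[of _ True]) simp
  next
    case False
    then show ?thesis using Scalar
      by (intro exI[of _ j] exI[of _ Equal] exI[of _ True] exI[of _ True]) simp
  qed
next
  case (Sqrt j)
  then show ?thesis
    by (intro exI[of _ j] exI[of _ GreaterEq] exI[of _ True] exI[of _ False]) simp
qed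

lemma computations_tests_eq_0: "computations t = 0 \<Longrightarrow> tests t = 0 \<Longrightarrow> \<exists>b. t = Leaf b"
  by (cases t) auto

text \<open>With \<open>m = computations T + 2 * tests T\<close> and \<open>m \<le> m ^ k\<close>,
  it suffices that \<open>tests T + 1 \<le> 2 * m\<close> if there is a test, and that
  \<open>3 \<le> 2 * m\<close> if there are only computations. The latter fails exactly for a single
  computation. For \<open>k = 0\<close> nothing is accepted, as the root is internal.\<close>

lemma act_components_bound:
  assumes T: "act_on n T" and A: "finite A" "pairwise_disconnected {x \<in> topspace (Euclidean_space n). accepts k T x} A"
  shows "3 * card A \<le> 2 * card (act_edges T) ^ k * 9 ^ k * 3 ^ n"
proof -
  define m where "m = card (act_edges T)"
  have dist: "distinct (vertices T)" and ne: "vertices T \<noteq> []" and refs: "refs_ok {..<n} T"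
    using T by (auto simp: act_on_def)
  have fresh: "set (vertices T) \<inter> {..<n} = {}" using T by (auto simp: act_on_def)
  have m: "m = computations T + 2 * tests T" using card_act_edges[OF dist] by (simp add: m_def)
  have "\<exists>N. card A \<le> N * 3 ^ n \<and> 3 * N \<le> 2 * m ^ k * 9 ^ k"
  proof (cases "k = 0")
    case True
    then have "A = {}" using A(2) ne by (cases T) (auto simp: pairwise_disconnected_def)
    then show ?thesis by (intro exI[of _ 0]) simp
  next
    case k: False
    have bound: "card A \<le> component_bound k T * 3 ^ n"
      by (rule accepting_set_components_bound[OF refs dist fresh A])
    have "m \<le> m ^ k" using k by (cases "m = 0") (simp_all add: self_le_power)
    then have step: "c * 9 ^ k \<le> 2 * m ^ k * 9 ^ k" if "c \<le> 2 * m" for c :: nat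
      using that by (intro mult_le_mono1) linarith
    consider "0 < tests T" | "tests T = 0" "2 \<le> computations T" | "tests T = 0" "computations T = 1"
      using computations_tests_eq_0[of T] ne by fastforce
    then show ?thesis
    proof cases
      case 1
      then have "3 * component_bound k T \<le> (tests T + 1) * 9 ^ k" by (rule component_bound_le_tests)
      also have "\<dots> \<le> 2 * m ^ k * 9 ^ k" using 1 m by (intro step) simp
      finally show ?thesis using bound by blast
    next
      case 2
      then have "3 * component_bound k T \<le> 3 * 9 ^ k" using component_bound_le[of k T] by simp
      also have "\<dots> \<le> 2 * m ^ k * 9 ^ k" using 2 m by (intro step) simp
      finally show ?thesis using bound by blast
    next
      case 3
      then obtain v p b where Tp: "T = Compute v p (Leaf b)"
        by (cases T) (auto dest: computations_tests_eq_0)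
      obtain i r c c' where dom: "i \<in> operands p"
          "\<And>x. x \<in> operation_dom p \<longleftrightarrow> (if holds_zero r (x i) then c else c')"
        using operation_dom_as_test by metis
      \<comment> \<open>A lone computation vertex would cost a factor 9, too much if \<open>k = 1\<close>; its value is never
        used and its domain is a sign condition, so a test vertex accepts the same inputs.\<close>
      define T' where "T' = Test v i r (Leaf (c \<and> b)) (Leaf (c' \<and> b))"
      obtain k' where k': "k = Suc k'" using k by (cases k) auto
      have "accepts k T x \<longleftrightarrow> accepts k T' x" for x
        using dom(2)[of x] by (simp add: k' Tp T'_def)
      then have "pairwise_disconnected {x \<in> topspace (Euclidean_space n). accepts k T' x} A"
        using A(2) by simp
      then have "card A \<le> component_bound k T' * 3 ^ n"
        using refs fresh dom(1) A(1) by (intro accepting_set_components_bound) (auto simp: T'_def Tp)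
      \<comment> \<open>Two leaves at cost 3 each; since \<open>3 * 6 = 2 * 9\<close>, nothing is
        left to spare when \<open>k = 1\<close>.\<close>
      moreover have "component_bound k T' \<le> 6" by (simp add: k' T'_def)
      moreover have "3 * 6 \<le> 2 * m ^ k * 9 ^ k" using 3 m by (simp add: k')
      ultimately show ?thesis by (intro exI[of _ 6]) (meson mult_le_mono1 order_trans)
    qed
  qed
  then obtain N where N: "card A \<le> N * 3 ^ n" "3 * N \<le> 2 * m ^ k * 9 ^ k" by blast
  have "3 * card A \<le> (3 * N) * 3 ^ n" using N(1) by simp
  also have "\<dots> \<le> 2 * m ^ k * 9 ^ k * 3 ^ n" using N(2) by (rule mult_le_mono1)
  finally show ?thesis by (simp add: m_def)
qed

text \<open>Choosing a point in each member of a finite family of components gives a pairwise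
  disconnected set. A uniform bound on all finite subfamilies also yields finiteness.\<close>

lemma connected_components_of_card_le:
  assumes "\<And>A. finite A \<Longrightarrow> pairwise_disconnected W A \<Longrightarrow> card A \<le> N"
  shows "finite (connected_components_of (top_of_set W)) \<and> card (connected_components_of (top_of_set W)) \<le> N"
proof (rule finite_if_finite_subsets_card_bdd)
  let ?X = "top_of_set W"
  fix \<C> assume \<C>: "\<C> \<subseteq> connected_components_of ?X" "finite \<C>"
  define r where "r C = (SOME x. x \<in> C)" for C :: "'a set"
  have r: "r C \<in> C" if "C \<in> \<C>" for C
    using nonempty_connected_components_of \<C>(1) that unfolding r_def by (metis some_in_eq subsetD)
  have C_eq: "C = connected_component_of_set ?X (r C)" if C: "C \<in> \<C>" for C
  proof -
    obtain y where y: "C = connected_component_of_set ?X y" using \<C>(1) C by (auto simp: connected_components_of_def)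
    then have "connected_component_of ?X y (r C)" using r[OF C] by simp
    then have "connected_component_of ?X y = connected_component_of ?X (r C)"
      by (simp add: connected_component_of_equiv)
    then show ?thesis using y by simp
  qed
  have inj: "C = C'" if "C \<in> \<C>" "C' \<in> \<C>" "connected_component W (r C) (r C')" for C C'
  proof -
    have "connected_component_of ?X (r C) (r C')"
      using that(3) by (auto simp: connected_component_of_def connected_component_def connectedin_subtopology)
    then have "connected_component_of ?X (r C) = connected_component_of ?X (r C')"
      by (simp add: connected_component_of_equiv)
    then show ?thesis using C_eq that by metis
  qed
  have sub: "r ` \<C> \<subseteq> W"
    using r \<C>(1) connected_components_of_subset[of _ ?X] by fastforce
  have "pairwise_disconnected W (r ` \<C>)"
    unfolding pairwise_disconnected_def using sub inj by blast
  then have "card (r ` \<C>) \<le> N" using assms \<C>(2) by blast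
  moreover have "inj_on r \<C>"
  proof (rule inj_onI)
    fix C C' assume "C \<in> \<C>" "C' \<in> \<C>" "r C = r C'"
    then show "C = C'" using inj[of C C'] sub by auto
  qed
  ultimately show "card \<C> \<le> N" by (simp add: card_image)
qed

text \<open>Passes from the abstract topology of the statement to the type class topology in which
  the zero sets are studied.\<close>

lemma subtopology_Euclidean_space:
  assumes "W \<subseteq> topspace (Euclidean_space n)" shows "subtopology (Euclidean_space n) W = top_of_set W"
  using assms unfolding topspace_Euclidean_space
  by (simp add: Euclidean_space_def subtopology_subtopology Int_absorb1 euclidean_product_topology)

lemma card_Seq: "finite E \<Longrightarrow> card (Seq k E) = card E ^ k"
  using card_lists_length_eq[of E k] by (simp add: Seq_def conj_commute)

theorem theorem8:
  fixes n k :: nat and T :: act and W :: "(nat \<Rightarrow> real) set"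
  assumes "act_on n T"
    and "W \<subseteq> topspace (Euclidean_space n)"
    and "computes_membership (translation T) n W k"
  shows "finite (connected_components_of (subtopology (Euclidean_space n) W)) \<and>
    real (card (connected_components_of (subtopology (Euclidean_space n) W)))
      \<le> real (card (Seq k (edges (translation T))))
         * 2 powr (real k * state_cover_entropy (translation T) + 1)
         * 3 powr (2 * real k + real n - 1)"
proof -
  have root: "root_state T = Vertex n" using assms(1) by (cases T) (auto simp: act_on_def)
  have W: "W = {x \<in> topspace (Euclidean_space n). accepts k T x}"
    using assms(2,3) accepts_iff[OF embedded_translation[OF assms(1)], of k] root
    by (auto simp: computes_membership_def)
  have edges: "edges (translation T) = act_edges T" by (simp add: translation_def)
  define m where "m = card (act_edges T)"
  have fin: "finite (act_edges T)" using card_act_edges assms(1) by (auto simp: act_on_def)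
  \<comment> \<open>\<open>connected_components_of_card_le\<close> expects a natural number as
    bound, hence the integer division by 3.\<close>
  have "card A \<le> (2 * m ^ k * 9 ^ k * 3 ^ n) div 3" if "finite A" "pairwise_disconnected W A" for A
    using act_components_bound[OF assms(1) that(1), of k] that(2) by (simp add: W m_def less_eq_div_iff_mult_less_eq mult.commute)
  from connected_components_of_card_le[OF this]
  have fin_comp: "finite (connected_components_of (top_of_set W))"
    and card_le: "card (connected_components_of (top_of_set W)) \<le> (2 * m ^ k * 9 ^ k * 3 ^ n) div 3"
    by blast+
  have "3 * card (connected_components_of (top_of_set W)) \<le> 2 * m ^ k * 9 ^ k * 3 ^ n"
    using card_le by linarith
  then have "real (3 * card (connected_components_of (top_of_set W))) \<le> real (2 * m ^ k * 9 ^ k * 3 ^ n)"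
    by (rule of_nat_mono)
  then have "real (card (connected_components_of (top_of_set W))) \<le> real m ^ k * 2 * (9 ^ k * 3 ^ n / 3)"
    by simp
  also have "(9 :: real) ^ k * 3 ^ n / 3 = 3 powr (2 * real k + real n - 1)"
  proof -
    have "3 powr (2 * real k + real n - 1) = 3 powr real (2 * k + n) / (3 :: real)"
      by (simp add: powr_diff)
    also have "\<dots> = 3 ^ (2 * k + n) / 3" by (subst powr_realpow) simp_all
    finally show ?thesis by (simp add: power_add power_mult)
  qed
  finally have "real (card (connected_components_of (top_of_set W)))
      \<le> real (card (Seq k (edges (translation T))))
         * 2 powr (real k * state_cover_entropy (translation T) + 1)
         * 3 powr (2 * real k + real n - 1)"
    by (simp add: state_cover_entropy_translation[OF assms(1)] card_Seq[OF fin] edges m_def)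
  then show ?thesis using fin_comp subtopology_Euclidean_space[OF assms(2)] by simp
qed

end
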